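(* For any $\alpha \in (0,2]$ there exists a constant $C_\alpha > 0$ depending only on $\alpha$ such that the following holds. Let $X_1, \ldots, X_n$ be independent, centered real random variables such that $\lVert X_i \rVert_{\Psi_\alpha} \le K$ for every $i$, and let $A = (a_{ij})$ be a real symmetric $n \times n$ matrix. Write $X = (X_1,\ldots,X_n)$. Then, for any $t \ge 0$, $$\mathbb{P}\big(|X^TAX - \mathbb{E} X^TAX| \ge t\big) \le 2 \exp\Big( - \frac{1}{C_\alpha} \min\Big( \frac{t^2}{K^4 \lVert A\rVert_{\mathrm{HS}}^2}, \Big( \frac{t}{K^2 \lVert A\rVert_{\mathrm{op}}}\Big)^{\frac{\alpha}{2}} \Big)\Big).$$
   Context: For a real random variable $X$ and $\alpha>0$, the Orlicz (quasi-)norm is $\lVert X \rVert_{\Psi_\alpha} := \inf \{t > 0 : \mathbb{E} \exp ((|X|/t)^\alpha) \le 2 \}$. For a matrix $A=(a_{ij})$, $\lVert A \rVert_{\mathrm{HS}} := (\sum_{i,j} a_{ij}^2)^{1/2}$ and $\lVert A \rVert_{\mathrm{op}} := \sup\{ \lVert Ax \rVert_2 : \lVert x \rVert_2 = 1\}$, where $\lVert\cdot\rVert_2$ is the Euclidean norm. The constant $C_\alpha$ does not depend on $n$, $K$, $A$, $t$ or the distributions of the $X_i$. *)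

theory Defs
  imports "HOL-Probability.Probability"
begin

text \<open>
  The infimum is taken in \<^typ>\<open>ereal\<close> and the expectation is a nonnegative integral, so that a
  random variable without finite exponential moments gets the norm \<open>\<infinity>\<close>; over the reals both the
  infimum of the empty set and the integral of a non-integrable function are junk values.
\<close>

definition orlicz_norm :: "'a measure \<Rightarrow> real \<Rightarrow> ('a \<Rightarrow> real) \<Rightarrow> ereal" where
  "orlicz_norm M \<alpha> X =
     (INF t \<in> {t::real. 0 < t \<and> (\<integral>\<^sup>+ \<omega>. ennreal (exp ((\<bar>X \<omega>\<bar> / t) powr \<alpha>)) \<partial>M) \<le> 2}. ereal t)"

text \<open>
  Since the constant must not depend on \<open>n\<close>, the dimension cannot be a type: an \<open>n \<times> n\<close> matrix is a
  function \<^typ>\<open>nat \<Rightarrow> nat \<Rightarrow> real\<close> and a vector a function \<^typ>\<open>nat \<Rightarrow> real\<close>, of which only the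
  entries with indices below \<open>n\<close> are used.
\<close>

definition quad_form :: "nat \<Rightarrow> (nat \<Rightarrow> nat \<Rightarrow> real) \<Rightarrow> (nat \<Rightarrow> real) \<Rightarrow> real" where
  "quad_form n A x = (\<Sum>i<n. \<Sum>j<n. x i * A i j * x j)"

definition hs_norm :: "nat \<Rightarrow> (nat \<Rightarrow> nat \<Rightarrow> real) \<Rightarrow> real" where
  "hs_norm n A = sqrt (\<Sum>i<n. \<Sum>j<n. (A i j)\<^sup>2)"

definition op_norm :: "nat \<Rightarrow> (nat \<Rightarrow> nat \<Rightarrow> real) \<Rightarrow> real" where
  "op_norm n A =
     (SUP x \<in> {x. L2_set x {..<n} = 1}. L2_set (\<lambda>i. \<Sum>j<n. A i j * x j) {..<n})"

text \<open>
  The tail bound with constant \<open>C\<close>, for all probability spaces over the sample type \<^typ>\<open>'a\<close>.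
  For \<open>K = 0\<close> or \<open>A = 0\<close>, where the quotients make no sense on paper, \<open>x / 0 = 0\<close> turns the
  right-hand side into \<open>2\<close>.
\<close>

definition quad_form_tail_bound :: "'a itself \<Rightarrow> real \<Rightarrow> real \<Rightarrow> bool" where
  "quad_form_tail_bound (_ :: 'a itself) \<alpha> C \<longleftrightarrow>
     (\<forall>(M :: 'a measure) (n :: nat) (X :: nat \<Rightarrow> 'a \<Rightarrow> real) (K :: real)
        (A :: nat \<Rightarrow> nat \<Rightarrow> real) (t :: real).
        prob_space M \<longrightarrow>
        1 \<le> n \<longrightarrow>
        prob_space.indep_vars M (\<lambda>_. borel) X {..<n} \<longrightarrow>
        (\<forall>i<n. integrable M (X i) \<and> (\<integral>\<omega>. X i \<omega> \<partial>M) = 0) \<longrightarrow>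
        (\<forall>i<n. orlicz_norm M \<alpha> (X i) \<le> ereal K) \<longrightarrow>
        (\<forall>i<n. \<forall>j<n. A i j = A j i) \<longrightarrow>
        0 \<le> t \<longrightarrow>
        measure M {\<omega> \<in> space M.
            t \<le> \<bar>quad_form n A (\<lambda>i. X i \<omega>) - (\<integral>\<omega>'. quad_form n A (\<lambda>i. X i \<omega>') \<partial>M)\<bar>}
          \<le> 2 * exp (- (1 / C) *
               min (t\<^sup>2 / (K ^ 4 * (hs_norm n A)\<^sup>2))
                   ((t / (K\<^sup>2 * op_norm n A)) powr (\<alpha> / 2))))"

end

theory Submission
  imports Defs
begin

text \<open>
  Fix an even \<open>p\<close> and let \<open>B = p powr (1/\<alpha> - 1/2)\<close>. Up to order \<open>p\<close>, the moments of a centered variable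
  of Orlicz norm \<open>K\<close> are dominated by those of \<open>c K B \<delta> g\<close>, where \<open>g\<close> is standard normal and \<open>\<delta>\<close> is an
  independent Bernoulli variable of mean \<open>B\<^sup>-\<^sup>2\<close>. The off-diagonal part of the quadratic form is affine in
  each variable, so the variables can be exchanged one at a time inside its \<open>p\<close>-th moment. The sparse
  Gaussian chaos has a sub-exponential moment generating function: given the \<open>\<delta>\<^sub>i\<close>, the Gaussian integral
  is computed by successive Schur complements, and deleting rows and columns does not increase the
  operator norm. The diagonal part is a sum of independent centered variables, which are dominated by
  products of two independent copies of the sparse variable. The resulting bound
  \<open>C K\<^sup>2 (\<surd>p \<parallel>A\<parallel>\<^sub>H\<^sub>S + p powr (2/\<alpha>) \<parallel>A\<parallel>\<^sub>o\<^sub>p)\<close> of the \<open>p\<close>-th central moment gives the tail bound by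
  Markov's inequality, with \<open>p\<close> of the order of the minimum in the exponent.
\<close>

section \<open>Sparse normal variables\<close>

abbreviation std_normal :: "real measure" where
  "std_normal \<equiv> density lborel std_normal_density"

lemma prob_space_std_normal: "prob_space std_normal"
  by (rule prob_space_normal_density) simp

interpretation std_normal: prob_space std_normal
  by (rule prob_space_std_normal)

lemma nn_integral_std_normal_exp_quadratic:
  assumes "s < 1"
  shows "(\<integral>\<^sup>+z. ennreal (exp (s / 2 * z\<^sup>2 + b * z)) \<partial>std_normal)
    = ennreal (exp (b\<^sup>2 / (2 * (1 - s))) / sqrt (1 - s))"
proof -
  define \<tau> where "\<tau> = 1 / sqrt (1 - s)"
  define m where "m = b / (1 - s)"
  have \<tau>: "0 < \<tau>" using assms by (simp add: \<tau>_def)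
  have \<tau>2: "\<tau>\<^sup>2 = 1 / (1 - s)" using assms by (simp add: \<tau>_def power_divide)
  have *: "std_normal_density z * exp (s / 2 * z\<^sup>2 + b * z)
      = (exp (b\<^sup>2 / (2 * (1 - s))) / sqrt (1 - s)) * normal_density m \<tau> z" for z
  proof -
    have "- z\<^sup>2 / 2 + (s / 2 * z\<^sup>2 + b * z) = b\<^sup>2 / (2 * (1 - s)) + - (z - m)\<^sup>2 / (2 * \<tau>\<^sup>2)"
    proof -
      define r where "r = 1 - s"
      have r: "r \<noteq> 0" "s = 1 - r" "b = m * r" using assms by (auto simp: r_def m_def)
      have 1: "b\<^sup>2 / (2 * r) = m\<^sup>2 * r / 2" "- (z - m)\<^sup>2 / (2 * (1 / r)) = - (z - m)\<^sup>2 * r / 2"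
        using r(1) by (simp_all add: r(3) field_simps power2_eq_square)
      show ?thesis unfolding \<tau>2 r_def[symmetric] 1 unfolding r(2,3)
        by (simp add: field_simps power2_eq_square)
    qed
    then have "exp (- z\<^sup>2 / 2) * exp (s / 2 * z\<^sup>2 + b * z)
        = exp (b\<^sup>2 / (2 * (1 - s))) * exp (- (z - m)\<^sup>2 / (2 * \<tau>\<^sup>2))"
      unfolding exp_add[symmetric] by simp
    moreover have "sqrt (2 * pi * \<tau>\<^sup>2) = sqrt (2 * pi) / sqrt (1 - s)"
      unfolding \<tau>2 by (simp add: real_sqrt_divide[symmetric])
    moreover have "sqrt (1 - s) > 0" using assms by simp
    ultimately show ?thesis unfolding normal_density_def
      by (simp add: field_simps)
  qed
  have "(\<integral>\<^sup>+z. ennreal (exp (s / 2 * z\<^sup>2 + b * z)) \<partial>std_normal)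
      = (\<integral>\<^sup>+z. ennreal (exp (b\<^sup>2 / (2 * (1 - s))) / sqrt (1 - s)) * ennreal (normal_density m \<tau> z) \<partial>lborel)"
    using assms by (subst nn_integral_density)
      (auto simp flip: ennreal_mult' simp add: * simp del: times_divide_eq_left intro!: nn_integral_cong)
  also have "\<dots> = ennreal (exp (b\<^sup>2 / (2 * (1 - s))) / sqrt (1 - s)) * (\<integral>\<^sup>+z. ennreal (normal_density m \<tau> z) \<partial>lborel)"
    by (rule nn_integral_cmult) simp
  also have "(\<integral>\<^sup>+z. ennreal (normal_density m \<tau> z) \<partial>lborel) = 1"
    using integrable_normal_density[OF \<tau>] integral_normal_density[OF \<tau>]
    by (subst nn_integral_eq_integral) auto
  finally show ?thesis by simp
qed

definition normal_moment :: "nat \<Rightarrow> real" where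
  "normal_moment k = (if even k then fact k / (2 ^ (k div 2) * fact (k div 2)) else 0)"

lemma std_normal_moment:
  "integrable std_normal (\<lambda>z. z ^ k)" "(\<integral>z. z ^ k \<partial>std_normal) = normal_moment k"
proof -
  have "has_bochner_integral lborel (\<lambda>z. std_normal_density z * z ^ k) (normal_moment k)"
  proof (cases "even k")
    case True
    then obtain j where "k = 2 * j" by blast
    then show ?thesis using normal_moment_even[of 1 0 j] by (simp add: normal_moment_def)
  next
    case False
    then obtain j where "k = 2 * j + 1" by (blast elim: oddE)
    then show ?thesis using normal_moment_odd[of 1 0 j] by (simp add: normal_moment_def)
  qed
  then show "integrable std_normal (\<lambda>z. z ^ k)" "(\<integral>z. z ^ k \<partial>std_normal) = normal_moment k"
    by (auto simp: integrable_density integral_density has_bochner_integral_iff)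
qed

lemma normal_moment_nonneg: "0 \<le> normal_moment k"
  by (simp add: normal_moment_def)

lemma normal_moment_lower:
  assumes "even k"
  shows "(k / 4) ^ (k div 2) \<le> normal_moment k"
proof -
  obtain j where k: "k = 2 * j" using assms by blast
  have "fact j * j ^ j \<le> (fact (2 * j) :: nat)"
  proof -
    have "fact j * j ^ j \<le> fact j * (\<Prod>i = Suc j..j + j. i)"
    proof -
      have "j ^ j = (\<Prod>i = Suc j..j + j. j)" by simp
      also have "\<dots> \<le> (\<Prod>i = Suc j..j + j. i)" by (rule prod_mono) auto
      finally show ?thesis by simp
    qed
    also have "\<dots> = fact (j + j)" 
      by (subst fact_eq_fact_times[of j "j + j"]) simp_all
    finally show ?thesis by (simp add: mult_2)
  qed
  then have "real (fact j * j ^ j) \<le> real (fact (2 * j))" by (simp only: of_nat_le_iff)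
  then have 1: "fact j * real j ^ j \<le> fact (2 * j)" by simp
  show ?thesis using 1 unfolding normal_moment_def k
    by (simp add: field_simps power_divide)
qed

definition sparse_normal :: "real \<Rightarrow> real \<Rightarrow> real measure" where
  "sparse_normal q b = distr (measure_pmf (bernoulli_pmf q) \<Otimes>\<^sub>M std_normal) borel
     (\<lambda>(d, z). if d then b * z else 0)"

lemma sets_sparse_normal [simp, measurable_cong]: "sets (sparse_normal q b) = sets borel"
  and space_sparse_normal [simp]: "space (sparse_normal q b) = UNIV"
  by (simp_all add: sparse_normal_def)

lemma measurable_sparse [measurable]:
  "(\<lambda>(d, z). if d then b * z else (0::real)) \<in>
    borel_measurable (measure_pmf (bernoulli_pmf q) \<Otimes>\<^sub>M std_normal)"
  by measurable

lemma prob_space_sparse_normal: "prob_space (sparse_normal q b)"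
proof -
  interpret pair_prob_space "measure_pmf (bernoulli_pmf q)" std_normal ..
  show ?thesis unfolding sparse_normal_def by (rule prob_space_distr) measurable
qed

lemma nn_integral_sparse_normal:
  assumes [measurable]: "F \<in> borel_measurable borel" and "0 \<le> q" "q \<le> 1"
  shows "(\<integral>\<^sup>+y. F y \<partial>sparse_normal q b) = ennreal (1 - q) * F 0 + ennreal q * (\<integral>\<^sup>+z. F (b * z) \<partial>std_normal)"
proof -
  interpret pair_sigma_finite "measure_pmf (bernoulli_pmf q)" std_normal ..
  have "(\<integral>\<^sup>+y. F y \<partial>sparse_normal q b)
     = (\<integral>\<^sup>+d. (\<integral>\<^sup>+z. F (if d then b * z else 0) \<partial>std_normal) \<partial>measure_pmf (bernoulli_pmf q))"
    unfolding sparse_normal_def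
    by (subst nn_integral_distr, simp, simp, subst std_normal.nn_integral_fst[symmetric])
       (auto simp: case_prod_beta)
  also have "\<dots> = ennreal (1 - q) * F 0 + ennreal q * (\<integral>\<^sup>+z. F (b * z) \<partial>std_normal)"
    using assms(2,3) std_normal.emeasure_space_1 by (simp add: mult.commute add.commute)
  finally show ?thesis .
qed

section \<open>Exchange of independent variables\<close>

lemma product_sigma_finite_prob:
  assumes "\<And>i. prob_space (\<mu> i)"
  shows "product_sigma_finite \<mu>"
  using assms by (auto intro: product_sigma_finite.intro prob_space_imp_sigma_finite)

lemma measurable_PiM_UNIV_real:
  fixes \<mu> :: "nat \<Rightarrow> real measure"
  assumes "\<And>i. i \<in> I \<Longrightarrow> sets (\<mu> i) = sets borel"
  shows "(\<lambda>x. x) \<in> measurable (Pi\<^sub>M I \<mu>) (Pi\<^sub>M UNIV (\<lambda>_. borel))"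
proof (rule measurable_PiM_single')
  fix i :: nat
  show "(\<lambda>x. x i) \<in> borel_measurable (Pi\<^sub>M I \<mu>)"
  proof (cases "i \<in> I")
    case True
    then have "(\<lambda>x. x i) \<in> measurable (Pi\<^sub>M I \<mu>) (\<mu> i)" by measurable
    then show ?thesis using assms[OF True] measurable_cong_sets by blast
  next
    case False
    then have "(\<lambda>x. x i) \<in> borel_measurable (Pi\<^sub>M I \<mu>) \<longleftrightarrow> (\<lambda>x. undefined :: real) \<in> borel_measurable (Pi\<^sub>M I \<mu>)"
      by (intro measurable_cong) (auto simp: space_PiM PiE_def extensional_def)
    then show ?thesis by simp
  qed
qed simp

lemma measurable_fun_upd_PiM:
  "(\<lambda>(x, y). x(i := y)) \<in> measurable (Pi\<^sub>M UNIV (\<lambda>_. borel) \<Otimes>\<^sub>M borel) (Pi\<^sub>M UNIV (\<lambda>_::nat. borel :: real measure))"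
proof (rule measurable_PiM_single')
  fix j :: nat
  show "(\<lambda>xa. (case xa of (x, y) \<Rightarrow> x(i := y)) j) \<in> borel_measurable (Pi\<^sub>M UNIV (\<lambda>_. borel) \<Otimes>\<^sub>M borel)"
    by (cases "j = i") (simp_all add: case_prod_beta)
qed simp

lemma measurable_fun_upd_const:
  "(\<lambda>x. x(i := y)) \<in> measurable (Pi\<^sub>M UNIV (\<lambda>_. borel)) (Pi\<^sub>M UNIV (\<lambda>_::nat. borel :: real measure))"
proof (rule measurable_PiM_single')
  fix j :: nat
  show "(\<lambda>x. (x(i := y)) j) \<in> borel_measurable (Pi\<^sub>M UNIV (\<lambda>_. borel))"
    by (cases "j = i") simp_all
qed simp

lemma nn_integral_PiM_affine_power_mono:
  fixes \<mu> \<nu> :: "nat \<Rightarrow> real measure"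
  assumes "finite I"
    and \<mu>: "\<And>i. prob_space (\<mu> i)" "\<And>i. sets (\<mu> i) = sets borel"
    and \<nu>: "\<And>i. prob_space (\<nu> i)" "\<And>i. sets (\<nu> i) = sets borel"
    and le: "\<And>i a b. i \<in> I \<Longrightarrow>
      (\<integral>\<^sup>+y. ennreal ((a + b * y) ^ p) \<partial>\<mu> i) \<le> (\<integral>\<^sup>+y. ennreal ((a + b * y) ^ p) \<partial>\<nu> i)"
    and "f \<in> borel_measurable (Pi\<^sub>M UNIV (\<lambda>_. borel))"
    and "\<And>i x. i \<in> I \<Longrightarrow> \<exists>b. \<forall>y. f (x(i := y)) = f (x(i := 0)) + b * (y :: real)"
  shows "(\<integral>\<^sup>+x. ennreal (f x ^ p) \<partial>Pi\<^sub>M I \<mu>) \<le> (\<integral>\<^sup>+x. ennreal (f x ^ p) \<partial>Pi\<^sub>M I \<nu>)"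
proof -
  interpret \<mu>: product_sigma_finite \<mu> by (rule product_sigma_finite_prob) fact
  interpret \<nu>: product_sigma_finite \<nu> by (rule product_sigma_finite_prob) fact
  show ?thesis
    using assms(1,7,8) le
  proof (induction I arbitrary: f rule: finite_induct)
    case empty
    show ?case by (simp add: PiM_empty)
  next
    case (insert i I)
    have meas: "(\<lambda>x. ennreal (f (h x) ^ p)) \<in> borel_measurable N"
      if "h \<in> measurable N (Pi\<^sub>M UNIV (\<lambda>_. borel))" for h and N :: "'z measure"
      by (intro measurable_compose[OF _ measurable_ennreal] borel_measurable_power
          measurable_compose[OF that insert.prems(1)])
    note m1 = meas[OF measurable_PiM_UNIV_real[of "insert i I" \<mu>, OF \<mu>(2)]]
      meas[OF measurable_PiM_UNIV_real[of "insert i I" \<nu>, OF \<nu>(2)]]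
    have upd: "(\<lambda>x. f (x(i := y))) \<in> borel_measurable (Pi\<^sub>M UNIV (\<lambda>_. borel))" for y
      by (rule measurable_compose[OF measurable_fun_upd_const insert.prems(1)])
    have "(\<integral>\<^sup>+x. ennreal (f x ^ p) \<partial>Pi\<^sub>M (insert i I) \<mu>)
        = (\<integral>\<^sup>+y. \<integral>\<^sup>+x. ennreal (f (x(i := y)) ^ p) \<partial>Pi\<^sub>M I \<mu> \<partial>\<mu> i)"
      by (rule \<mu>.product_nn_integral_insert_rev) (use insert.hyps m1 in auto)
    also have "\<dots> \<le> (\<integral>\<^sup>+y. \<integral>\<^sup>+x. ennreal (f (x(i := y)) ^ p) \<partial>Pi\<^sub>M I \<nu> \<partial>\<mu> i)"
    proof (rule nn_integral_mono, rule insert.IH)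
      fix y
      show "(\<lambda>x. f (x(i := y))) \<in> borel_measurable (Pi\<^sub>M UNIV (\<lambda>_. borel))" by (rule upd)
    next
      fix y j and x :: "nat \<Rightarrow> real" assume "j \<in> I"
      then have "j \<noteq> i" using insert.hyps by auto
      obtain b where "\<forall>v. f (x(i := y, j := v)) = f (x(i := y, j := 0)) + b * v"
        using insert.prems(2)[of j "x(i := y)"] \<open>j \<in> I\<close> by blast
      then show "\<exists>b. \<forall>ya. f (x(j := ya, i := y)) = f (x(j := 0, i := y)) + b * ya"
        unfolding fun_upd_twist[OF \<open>j \<noteq> i\<close>] by blast
    qed (use insert.prems in auto)
    also have "\<dots> = (\<integral>\<^sup>+x. \<integral>\<^sup>+y. ennreal (f (x(i := y)) ^ p) \<partial>\<mu> i \<partial>Pi\<^sub>M I \<nu>)"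
    proof (rule pair_sigma_finite.Fubini')
      interpret I: finite_product_sigma_finite \<nu> I by standard fact
      show "pair_sigma_finite (Pi\<^sub>M I \<nu>) (\<mu> i)"
        by (intro pair_sigma_finite.intro I.sigma_finite_measure_axioms \<mu>.sigma_finite_measures)
      have "(\<lambda>z. (fst z, snd z)) \<in> measurable (Pi\<^sub>M I \<nu> \<Otimes>\<^sub>M \<mu> i) (Pi\<^sub>M UNIV (\<lambda>_. borel) \<Otimes>\<^sub>M borel)"
        by (intro measurable_Pair measurable_compose[OF measurable_fst measurable_PiM_UNIV_real]
            measurable_snd'[OF _] measurable_snd'') (simp_all add: \<nu> \<mu> measurable_ident_sets)
      from meas[OF measurable_compose[OF this measurable_fun_upd_PiM[of i]]]
      show "(\<lambda>(x, y). ennreal (f (x(i := y)) ^ p)) \<in> borel_measurable (Pi\<^sub>M I \<nu> \<Otimes>\<^sub>M \<mu> i)"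
        by (simp add: case_prod_beta)
    qed
    also have "\<dots> \<le> (\<integral>\<^sup>+x. \<integral>\<^sup>+y. ennreal (f (x(i := y)) ^ p) \<partial>\<nu> i \<partial>Pi\<^sub>M I \<nu>)"
    proof (rule nn_integral_mono)
      fix x
      obtain b where "\<forall>y. f (x(i := y)) = f (x(i := 0)) + b * y"
        using insert.prems(2)[of i x] by blast
      then have "(\<lambda>y. ennreal (f (x(i := y)) ^ p)) = (\<lambda>y. ennreal ((f (x(i := 0)) + b * y) ^ p))"
        by metis
      then show "(\<integral>\<^sup>+y. ennreal (f (x(i := y)) ^ p) \<partial>\<mu> i) \<le> (\<integral>\<^sup>+y. ennreal (f (x(i := y)) ^ p) \<partial>\<nu> i)"
        using insert.prems(3)[of i "f (x(i := 0))" b] by (simp only: insertI1)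
    qed
    also have "\<dots> = (\<integral>\<^sup>+x. ennreal (f x ^ p) \<partial>Pi\<^sub>M (insert i I) \<nu>)"
      by (rule \<nu>.product_nn_integral_insert[symmetric]) (use insert.hyps m1 in auto)
    finally show ?case .
  qed
qed

text \<open>
  The expectation of \<open>F \<delta>\<close> for \<open>\<delta>\<close> with independent Bernoulli coordinates below \<open>n\<close> and zeros elsewhere.
  The recursion instead of a product measure spares all measurability conditions in \<open>\<delta>\<close>.
\<close>

definition bernoulli_mean :: "real \<Rightarrow> nat \<Rightarrow> ((nat \<Rightarrow> real) \<Rightarrow> ennreal) \<Rightarrow> ennreal" where
  "bernoulli_mean q n = rec_nat (\<lambda>F. F (\<lambda>_. 0))
     (\<lambda>n E F. ennreal (1 - q) * E (\<lambda>d. F (d(n := 0))) + ennreal q * E (\<lambda>d. F (d(n := 1)))) n"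

lemma bernoulli_mean_simps [simp]:
  "bernoulli_mean q 0 F = F (\<lambda>_. 0)"
  "bernoulli_mean q (Suc n) F = ennreal (1 - q) * bernoulli_mean q n (\<lambda>d. F (d(n := 0)))
     + ennreal q * bernoulli_mean q n (\<lambda>d. F (d(n := 1)))"
  by (simp_all add: bernoulli_mean_def)

lemma bernoulli_mean_mono:
  assumes "\<And>d. range d \<subseteq> {0, 1} \<Longrightarrow> F d \<le> G d"
  shows "bernoulli_mean q n F \<le> bernoulli_mean q n G"
  using assms
proof (induction n arbitrary: F G)
  case 0
  then show ?case by simp
next
  case (Suc n)
  have "range (d(n := y)) \<subseteq> {0, 1}" if "range d \<subseteq> {0, 1}" "y \<in> {0, 1}" for d :: "nat \<Rightarrow> real" and y
    using that by auto
  then show ?case unfolding bernoulli_mean_simps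
    by (intro add_mono mult_left_mono Suc.IH Suc.prems) auto
qed

lemma nn_integral_bernoulli_mean:
  assumes "\<And>d. (\<lambda>z. F z d) \<in> borel_measurable M"
  shows "(\<lambda>z. bernoulli_mean q n (F z)) \<in> borel_measurable M"
    and "(\<integral>\<^sup>+z. bernoulli_mean q n (F z) \<partial>M) = bernoulli_mean q n (\<lambda>d. \<integral>\<^sup>+z. F z d \<partial>M)"
  using assms
proof (induction n arbitrary: F)
  case (Suc n)
  {
    case 1
    note [measurable] = Suc.IH(1)[of "\<lambda>z d. F z (d(n := 0))"] Suc.IH(1)[of "\<lambda>z d. F z (d(n := 1))"]
    show ?case using 1 by simp
  next
    case 2
    note [measurable] = Suc.IH(1)[of "\<lambda>z d. F z (d(n := 0))"] Suc.IH(1)[of "\<lambda>z d. F z (d(n := 1))"]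
    show ?case using 2 Suc.IH(2) by (simp add: nn_integral_add nn_integral_cmult)
  }
qed simp_all

lemma bernoulli_mean_cmult:
  "bernoulli_mean q n (\<lambda>d. k * F d) = k * bernoulli_mean q n F"
  by (induction n arbitrary: F) (simp_all add: algebra_simps)

lemma two_point_exp_le:
  fixes q u :: real
  assumes "0 \<le> q" "q \<le> 1" "0 \<le> u" "u \<le> 1"
  shows "1 - q + q * exp u \<le> exp (2 * q * u)"
proof -
  have "u\<^sup>2 \<le> u" using assms(3,4) by (simp add: power2_eq_square mult_left_le)
  then have "exp u \<le> 1 + 2 * u" using exp_bound[of u] assms by simp
  then have "q * exp u \<le> q * (1 + 2 * u)" using assms by (intro mult_left_mono)
  moreover have "1 + 2 * q * u \<le> exp (2 * q * u)" by (rule exp_ge_add_one_self)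
  moreover have "q * (1 + 2 * u) = q + 2 * q * u" by (simp add: algebra_simps)
  ultimately show ?thesis by linarith
qed

lemma bernoulli_mean_exp_quadratic:
  fixes w :: "nat \<Rightarrow> nat \<Rightarrow> real"
  assumes q: "0 \<le> q" "q \<le> 1"
    and w: "\<And>i j. 0 \<le> w i j" "\<And>i j. w i j = w j i" "\<And>i. w i i = 0"
    and "\<And>i. i < n \<Longrightarrow> 0 \<le> c i" "\<And>i. i < n \<Longrightarrow> c i + 4 * (\<Sum>j<n. w i j) \<le> 1"
  shows "bernoulli_mean q n (\<lambda>d. ennreal (exp ((\<Sum>i<n. \<Sum>j<n. w i j * d i * d j) + (\<Sum>i<n. c i * d i))))
    \<le> ennreal (exp (2 * q * (\<Sum>i<n. c i) + 4 * q\<^sup>2 * (\<Sum>i<n. \<Sum>j<n. w i j)))"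
  using assms(6,7)
proof (induction n arbitrary: c)
  case 0
  show ?case by simp
next
  case (Suc n)
  define W where "W = (\<Sum>i<n. \<Sum>j<n. w i j)"
  define R where "R = (\<Sum>i<n. w n i)"
  define S where "S = (\<Sum>i<n. c i)"
  define V where "V c = (\<lambda>d. ennreal (exp ((\<Sum>i<n. \<Sum>j<n. w i j * d i * d j) + (\<Sum>i<n. c i * d i))))"
    for c :: "nat \<Rightarrow> real"
  have R: "0 \<le> R" unfolding R_def by (intro sum_nonneg w)
  have cR: "c n + 4 * R \<le> 1" "0 \<le> c n"
    using Suc.prems(2)[of n] Suc.prems(1)[of n] by (simp_all add: R_def w(3))
  have Wn: "(\<Sum>i<Suc n. \<Sum>j<Suc n. w i j) = W + 2 * R"
  proof -
    have "(\<Sum>i<n. w i n) = R" unfolding R_def by (intro sum.cong refl w(2))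
    then show ?thesis by (simp add: sum.distrib W_def R_def w(3))
  qed
  have row: "(\<Sum>j<n. w i j) \<le> (\<Sum>j<Suc n. w i j)" for i using w(1) by simp
  have 0: "(\<lambda>d. ennreal (exp ((\<Sum>i<Suc n. \<Sum>j<Suc n. w i j * (d(n := 0)) i * (d(n := 0)) j) + (\<Sum>i<Suc n. c i * (d(n := 0)) i))))
      = V c"
    by (simp add: V_def)
  have 1: "ennreal (exp ((\<Sum>i<Suc n. \<Sum>j<Suc n. w i j * (d(n := 1)) i * (d(n := 1)) j) + (\<Sum>i<Suc n. c i * (d(n := 1)) i)))
      = ennreal (exp (c n)) * V (\<lambda>i. c i + 2 * w n i) d" for d
  proof -
    have "(\<Sum>i<n. w i n * d i) = (\<Sum>i<n. w n i * d i)" by (intro sum.cong refl) (simp add: w(2))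
    then have "(\<Sum>i<Suc n. \<Sum>j<Suc n. w i j * (d(n := 1)) i * (d(n := 1)) j) + (\<Sum>i<Suc n. c i * (d(n := 1)) i)
      = c n + ((\<Sum>i<n. \<Sum>j<n. w i j * d i * d j) + (\<Sum>i<n. (c i + 2 * w n i) * d i))"
      by (simp add: sum.distrib w(3) distrib_right mult.assoc sum_distrib_left[symmetric])
    then show ?thesis unfolding V_def by (simp only: exp_add[of "c n"] ennreal_mult' exp_ge_zero)
  qed
  have V0: "bernoulli_mean q n (V c) \<le> ennreal (exp (2 * q * S + 4 * q\<^sup>2 * W))"
    unfolding S_def W_def V_def
  proof (rule Suc.IH)
    fix i assume "i < n"
    then show "0 \<le> c i" "c i + 4 * (\<Sum>j<n. w i j) \<le> 1"
      using Suc.prems[of i] row[of i] by auto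
  qed
  have V1: "bernoulli_mean q n (V (\<lambda>i. c i + 2 * w n i)) \<le> ennreal (exp (2 * q * (S + 2 * R) + 4 * q\<^sup>2 * W))"
  proof -
    have "bernoulli_mean q n (V (\<lambda>i. c i + 2 * w n i))
      \<le> ennreal (exp (2 * q * (\<Sum>i<n. c i + 2 * w n i) + 4 * q\<^sup>2 * W))"
      unfolding W_def V_def
    proof (rule Suc.IH)
      fix i assume i: "i < n"
      then show "0 \<le> c i + 2 * w n i" using Suc.prems[of i] w(1) by simp
      show "c i + 2 * w n i + 4 * (\<Sum>j<n. w i j) \<le> 1"
        using Suc.prems(2)[of i] i w(1)[of n i] w(2)[of n i] by simp
    qed
    then show ?thesis by (simp add: sum.distrib S_def R_def sum_distrib_left)
  qed
  have "bernoulli_mean q (Suc n) (\<lambda>d. ennreal (exp ((\<Sum>i<Suc n. \<Sum>j<Suc n. w i j * d i * d j) + (\<Sum>i<Suc n. c i * d i))))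
      = ennreal (1 - q) * bernoulli_mean q n (V c)
      + ennreal q * (ennreal (exp (c n)) * bernoulli_mean q n (V (\<lambda>i. c i + 2 * w n i)))"
    unfolding bernoulli_mean_simps 0 1 bernoulli_mean_cmult ..
  also have "\<dots> \<le> ennreal (1 - q) * ennreal (exp (2 * q * S + 4 * q\<^sup>2 * W))
      + ennreal q * (ennreal (exp (c n)) * ennreal (exp (2 * q * (S + 2 * R) + 4 * q\<^sup>2 * W)))"
    by (intro add_mono mult_left_mono V0 V1) auto
  also have "\<dots> = ennreal (exp (2 * q * S + 4 * q\<^sup>2 * W) * (1 - q + q * exp (c n + 4 * q * R)))"
  proof -
    have "(1 - q) * exp (2 * q * S + 4 * q\<^sup>2 * W) + q * (exp (c n) * exp (2 * q * (S + 2 * R) + 4 * q\<^sup>2 * W))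
      = exp (2 * q * S + 4 * q\<^sup>2 * W) * (1 - q + q * exp (c n + 4 * q * R))"
      by (simp add: exp_add[symmetric] algebra_simps)
    then show ?thesis using q by (simp add: ennreal_mult'[symmetric] ennreal_plus[symmetric] del: ennreal_plus)
  qed
  also have "\<dots> \<le> ennreal (exp (2 * q * S + 4 * q\<^sup>2 * W) * exp (2 * q * (c n + 4 * q * R)))"
  proof (intro ennreal_leI mult_left_mono two_point_exp_le)
    have "q * R \<le> R" using q R by (simp add: mult_left_le_one_le)
    then show "c n + 4 * q * R \<le> 1" using cR by simp
    show "0 \<le> c n + 4 * q * R" using cR q R by simp
  qed (use q in auto)
  also have "exp (2 * q * S + 4 * q\<^sup>2 * W) * exp (2 * q * (c n + 4 * q * R))
      = exp (2 * q * (\<Sum>i<Suc n. c i) + 4 * q\<^sup>2 * (\<Sum>i<Suc n. \<Sum>j<Suc n. w i j))"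
    unfolding Wn by (simp add: exp_add[symmetric] S_def algebra_simps power2_eq_square)
  finally show ?case .
qed

lemma nn_integral_PiM_sparse_normal:
  assumes q: "0 \<le> q" "q \<le> 1" and "F \<in> borel_measurable (Pi\<^sub>M UNIV (\<lambda>_. borel))"
    and "\<And>x y. (\<And>i. i < n \<Longrightarrow> x i = y i) \<Longrightarrow> F x = F y"
  shows "(\<integral>\<^sup>+x. F x \<partial>Pi\<^sub>M {..<n} (\<lambda>_. sparse_normal q b))
     = bernoulli_mean q n (\<lambda>d. \<integral>\<^sup>+x. F (\<lambda>i. d i * (b * x i)) \<partial>Pi\<^sub>M {..<n} (\<lambda>_. std_normal))"
  using assms(3,4)
proof (induction n arbitrary: F)
  case 0
  show ?case by (auto simp: PiM_empty nn_integral_count_space_finite intro: 0)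
next
  case (Suc n)
  interpret \<nu>: product_sigma_finite "\<lambda>_::nat. sparse_normal q b"
    by (rule product_sigma_finite_prob) (rule prob_space_sparse_normal)
  interpret N: product_sigma_finite "\<lambda>_::nat. std_normal"
    by (rule product_sigma_finite_prob) (rule prob_space_std_normal)
  interpret Nn: finite_product_sigma_finite "\<lambda>_::nat. std_normal" "{..<n}" by standard simp
  define H where "H d y = (\<integral>\<^sup>+g. F ((\<lambda>i. d i * (b * g i))(n := y)) \<partial>Pi\<^sub>M {..<n} (\<lambda>_. std_normal))"
    for d y
  have comp: "(\<lambda>g. g i) \<in> borel_measurable (Pi\<^sub>M I (\<lambda>_. std_normal))" for I and i :: nat
    by (rule measurable_compose[OF measurable_PiM_UNIV_real]) simp_all
  have H [measurable]: "H d \<in> borel_measurable borel" for d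
  proof -
    have "(\<lambda>z. (\<lambda>i. d i * (b * (snd z) i))(n := fst z))
      \<in> measurable (borel \<Otimes>\<^sub>M Pi\<^sub>M {..<n} (\<lambda>_. std_normal)) (Pi\<^sub>M UNIV (\<lambda>_. borel))"
    proof (rule measurable_PiM_single')
      fix j :: nat
      have "(\<lambda>z. d j * (b * snd z j)) \<in> borel_measurable (borel \<Otimes>\<^sub>M Pi\<^sub>M {..<n} (\<lambda>_. std_normal))"
        by (intro borel_measurable_times borel_measurable_const measurable_compose[OF measurable_snd comp])
      then      show "(\<lambda>z. ((\<lambda>i. d i * (b * (snd z) i))(n := fst z)) j)
        \<in> borel_measurable (borel \<Otimes>\<^sub>M Pi\<^sub>M {..<n} (\<lambda>_. std_normal))"
        by (cases "j = n") simp_all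
    qed simp
    from measurable_compose[OF this Suc.prems(1)] show ?thesis
      unfolding H_def by (intro Nn.borel_measurable_nn_integral) (simp only: case_prod_beta')
  qed
  have step: "(\<integral>\<^sup>+x. F (\<lambda>i. (d(n := v)) i * (b * x i)) \<partial>Pi\<^sub>M {..<Suc n} (\<lambda>_. std_normal))
      = (\<integral>\<^sup>+z. H d (v * (b * z)) \<partial>std_normal)" for d v
  proof -
    have "(\<lambda>x i. (d(n := v)) i * (b * x i)) \<in> measurable (Pi\<^sub>M (insert n {..<n}) (\<lambda>_. std_normal)) (Pi\<^sub>M UNIV (\<lambda>_. borel))"
      by (intro measurable_PiM_single' borel_measurable_times borel_measurable_const comp) simp
    from measurable_compose[OF this Suc.prems(1)]
    have "(\<integral>\<^sup>+x. F (\<lambda>i. (d(n := v)) i * (b * x i)) \<partial>Pi\<^sub>M {..<Suc n} (\<lambda>_. std_normal))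
      = (\<integral>\<^sup>+z. \<integral>\<^sup>+g. F (\<lambda>i. (d(n := v)) i * (b * (g(n := z)) i)) \<partial>Pi\<^sub>M {..<n} (\<lambda>_. std_normal) \<partial>std_normal)"
      unfolding lessThan_Suc by (subst N.product_nn_integral_insert_rev) auto
    moreover have "(\<lambda>i. (d(n := v)) i * (b * (g(n := z)) i)) = (\<lambda>i. d i * (b * g i))(n := v * (b * z))" for g z
      by auto
    ultimately show ?thesis unfolding H_def by (simp only:)
  qed
  have "(\<integral>\<^sup>+x. F x \<partial>Pi\<^sub>M {..<Suc n} (\<lambda>_. sparse_normal q b))
      = (\<integral>\<^sup>+y. \<integral>\<^sup>+x. F (x(n := y)) \<partial>Pi\<^sub>M {..<n} (\<lambda>_. sparse_normal q b) \<partial>sparse_normal q b)"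
    unfolding lessThan_Suc
    by (rule \<nu>.product_nn_integral_insert_rev)
      (use measurable_compose[OF measurable_PiM_UNIV_real Suc.prems(1), of "insert n {..<n}" "\<lambda>_. sparse_normal q b"] in auto)
  also have "\<dots> = (\<integral>\<^sup>+y. bernoulli_mean q n (\<lambda>d. H d y) \<partial>sparse_normal q b)"
    unfolding H_def
  proof (rule nn_integral_cong, rule Suc.IH)
    fix y :: real and x x' :: "nat \<Rightarrow> real"
    show "(\<lambda>x. F (x(n := y))) \<in> borel_measurable (Pi\<^sub>M UNIV (\<lambda>_. borel))"
      by (rule measurable_compose[OF measurable_fun_upd_const Suc.prems(1)])
    assume "\<And>i. i < n \<Longrightarrow> x i = x' i"
    then show "F (x(n := y)) = F (x'(n := y))"
      by (intro Suc.prems(2)) auto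
  qed
  also have "\<dots> = ennreal (1 - q) * bernoulli_mean q n (\<lambda>d. H d 0)
      + ennreal q * (\<integral>\<^sup>+z. bernoulli_mean q n (\<lambda>d. H d (b * z)) \<partial>std_normal)"
    using nn_integral_bernoulli_mean(1)[of "\<lambda>y d. H d y" borel q n] H q
    by (intro nn_integral_sparse_normal[of "\<lambda>y. bernoulli_mean q n (\<lambda>d. H d y)"]) auto
  also have "(\<integral>\<^sup>+z. bernoulli_mean q n (\<lambda>d. H d (b * z)) \<partial>std_normal)
      = bernoulli_mean q n (\<lambda>d. \<integral>\<^sup>+z. H d (b * z) \<partial>std_normal)"
    by (rule nn_integral_bernoulli_mean(2)[of "\<lambda>z d. H d (b * z)"]) measurable
  finally show ?case
    using std_normal.emeasure_space_1 unfolding bernoulli_mean_simps step by simp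
qed

section \<open>Gaussian quadratic exponential moments\<close>

lemma quad_form_cong:
  "(\<And>i. i < n \<Longrightarrow> x i = y i) \<Longrightarrow> quad_form n A x = quad_form n A y"
  by (simp add: quad_form_def)

lemma quad_form_Suc:
  assumes "\<And>i. i < n \<Longrightarrow> S i n = S n i"
  shows "quad_form (Suc n) S (x(n := z))
    = quad_form n S x + 2 * z * (\<Sum>i<n. S n i * x i) + S n n * z\<^sup>2"
proof -
  have "(\<Sum>i<n. x i * S i n * z) = z * (\<Sum>i<n. S n i * x i)"
    unfolding sum_distrib_left by (intro sum.cong refl) (simp add: assms)
  moreover have "(\<Sum>i<n. z * S n i * x i) = z * (\<Sum>i<n. S n i * x i)"
    unfolding sum_distrib_left by (simp add: mult.assoc)
  ultimately show ?thesis
    by (simp add: quad_form_def sum.distrib power2_eq_square)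
qed

lemma measurable_quad_form [measurable]:
  assumes "\<And>i. i < n \<Longrightarrow> (\<lambda>\<omega>. X \<omega> i) \<in> borel_measurable M"
  shows "(\<lambda>\<omega>. quad_form n A (X \<omega>)) \<in> borel_measurable M"
  unfolding quad_form_def using assms
  by (intro borel_measurable_sum borel_measurable_times) auto

lemma measurable_PiM_component_real:
  fixes \<mu> :: "nat \<Rightarrow> real measure"
  assumes "i \<in> I" "sets (\<mu> i) = sets borel"
  shows "(\<lambda>x. x i) \<in> borel_measurable (Pi\<^sub>M I \<mu>)"
  using measurable_component_singleton[OF assms(1), of \<mu>] assms(2) measurable_cong_sets by blast

lemma inverse_sqrt_le_exp:
  assumes "\<bar>s\<bar> \<le> 1 / 4"
  shows "1 / sqrt (1 - s) \<le> exp (s / 2 + s\<^sup>2)"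
proof -
  have "\<bar>ln (1 + - s) - - s\<bar> \<le> 2 * (- s)\<^sup>2"
    using assms by (intro abs_ln_one_plus_x_minus_x_bound) simp
  then have "- (ln (1 - s) / 2) \<le> s / 2 + s\<^sup>2" by simp
  then have "exp (- (ln (1 - s) / 2)) \<le> exp (s / 2 + s\<^sup>2)" by simp
  moreover have "exp (- (ln (1 - s) / 2)) = 1 / sqrt (1 - s)"
    using assms by (simp add: exp_minus ln_sqrt[symmetric] inverse_eq_divide)
  ultimately show ?thesis by simp
qed

lemma gaussian_exp_quad_form:
  fixes S :: "nat \<Rightarrow> nat \<Rightarrow> real"
  assumes "\<And>i j. S i j = S j i"
    and "\<And>x. \<bar>quad_form n S x\<bar> \<le> (\<Sum>i<n. (x i)\<^sup>2) / 4"
  shows "(\<integral>\<^sup>+x. ennreal (exp (quad_form n S x / 2)) \<partial>Pi\<^sub>M {..<n} (\<lambda>_. std_normal))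
    \<le> ennreal (exp ((\<Sum>i<n. S i i) / 2 + (\<Sum>i<n. \<Sum>j<n. (S i j)\<^sup>2)))"
  using assms
proof (induction n arbitrary: S)
  case 0
  show ?case by (simp add: PiM_empty quad_form_def nn_integral_count_space_finite)
next
  case (Suc n)
  interpret N: product_sigma_finite "\<lambda>_::nat. std_normal"
    by (rule product_sigma_finite_prob) (rule prob_space_std_normal)
  note sym = Suc.prems(1) and bnd = Suc.prems(2)
  define s where "s = S n n"
  define L where "L x = (\<Sum>i<n. S n i * x i)" for x
  \<comment> \<open>integrating out the last variable replaces \<open>I - S\<close> by its Schur complement \<open>I - S'\<close>\<close>
  define S' where "S' i j = S i j + S n i * S n j / (1 - s)" for i j
  define \<beta> where "\<beta> = (\<Sum>i<n. (S n i)\<^sup>2)"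
  define \<gamma> where "\<gamma> = quad_form n S (S n)"
  define h where "h = (\<Sum>i<n. \<Sum>j<n. (S i j)\<^sup>2)"
  define u where "u = 1 / (1 - s)"
  have split: "quad_form (Suc n) S (x(n := z)) = quad_form n S x + 2 * z * L x + s * z\<^sup>2" for x z
    unfolding L_def s_def by (rule quad_form_Suc) (rule sym)
  have bnd': "\<bar>quad_form n S x + 2 * z * L x + s * z\<^sup>2\<bar> \<le> ((\<Sum>i<n. (x i)\<^sup>2) + z\<^sup>2) / 4" for x z
    using bnd[of "x(n := z)"] unfolding split by simp
  have s: "\<bar>s\<bar> \<le> 1 / 4"
    using bnd'[of "\<lambda>_. 0" 1] by (simp add: quad_form_def L_def)
  then have s1: "s < 1" "1 - s > 0" by auto
  have L2: "(L x)\<^sup>2 = (\<Sum>i<n. \<Sum>j<n. x i * (S n i * S n j) * x j)" for x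
    unfolding L_def power2_eq_square sum_product by (simp add: ac_simps)
  have S': "quad_form n S' x = quad_form n S x + (L x)\<^sup>2 / (1 - s)" for x
    unfolding quad_form_def L2 S'_def
    by (simp add: sum.distrib algebra_simps sum_divide_distrib)
  have \<beta>0: "0 \<le> \<beta>" unfolding \<beta>_def by (intro sum_nonneg) simp
  have \<gamma>: "\<gamma> \<le> \<beta> / 4" "- \<beta> / 4 \<le> \<gamma>"
    using bnd'[of "S n" 0] by (simp_all add: \<gamma>_def \<beta>_def abs_le_iff)
  have \<beta>: "\<beta> \<le> 1 / 4"
  proof (cases "\<beta> = 0")
    case False
    then have "\<beta> > 0" using \<beta>0 by simp
    have L\<beta>: "L (S n) = \<beta>" by (simp add: L_def \<beta>_def power2_eq_square)
    have "\<gamma> + 2 * sqrt \<beta> * \<beta> + s * \<beta> \<le> (\<beta> + \<beta>) / 4"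
      using bnd'[of "S n" "sqrt \<beta>"]
      unfolding \<gamma>_def[symmetric] \<beta>_def[symmetric] real_sqrt_pow2[OF \<beta>0] L\<beta> by linarith
    moreover have "- (1 / 4) * \<beta> \<le> s * \<beta>"
      using s \<beta>0 by (intro mult_right_mono) auto
    ultimately have "2 * sqrt \<beta> * \<beta> \<le> 1 * \<beta>" using \<gamma> by simp
    then have "2 * sqrt \<beta> \<le> 1" using \<open>\<beta> > 0\<close> mult_le_cancel_right_pos by blast
    then have "(sqrt \<beta>)\<^sup>2 \<le> (1 / 2)\<^sup>2" using \<beta>0 by (intro power_mono) auto
    then show ?thesis using \<beta>0 by (simp add: power2_eq_square)
  qed simp
  have S'bnd: "\<bar>quad_form n S' x\<bar> \<le> (\<Sum>i<n. (x i)\<^sup>2) / 4" for x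
  proof -
    define \<tau> where "\<tau> = L x / (1 - s)"
    have \<tau>: "L x = \<tau> * (1 - s)" using s1 by (simp add: \<tau>_def)
    have "quad_form n S' x = quad_form n S x + \<tau>\<^sup>2 * (1 - s)"
      unfolding S' \<tau> using s1 by (simp add: power2_eq_square)
    moreover have "quad_form n S x + (2 * \<tau> * (\<tau> * (1 - s)) + s * \<tau>\<^sup>2) \<le> (\<Sum>i<n. (x i)\<^sup>2) / 4 + \<tau>\<^sup>2 / 4"
      using bnd'[of x \<tau>] unfolding \<tau> by (simp add: abs_le_iff add_divide_distrib)
    moreover have "2 * \<tau> * (\<tau> * (1 - s)) + s * \<tau>\<^sup>2 = \<tau>\<^sup>2 * (1 - s) + \<tau>\<^sup>2"
      by (simp add: power2_eq_square algebra_simps)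
    moreover have "0 \<le> \<tau>\<^sup>2 * (1 - s)" "0 \<le> \<tau>\<^sup>2" using s1 by auto
    moreover have "- (\<Sum>i<n. (x i)\<^sup>2) / 4 \<le> quad_form n S x" using bnd'[of x 0] by simp
    ultimately show ?thesis by linarith
  qed
  have tr': "(\<Sum>i<n. S' i i) = (\<Sum>i<n. S i i) + \<beta> * u"
    by (simp add: S'_def \<beta>_def u_def sum.distrib sum_divide_distrib power2_eq_square)
  have hs: "(\<Sum>i<Suc n. \<Sum>j<Suc n. (S i j)\<^sup>2) = h + 2 * \<beta> + s\<^sup>2"
  proof -
    have "(\<Sum>i<n. (S i n)\<^sup>2) = \<beta>" unfolding \<beta>_def by (intro sum.cong refl) (simp add: sym[of n])
    then show ?thesis by (simp add: sum.distrib h_def \<beta>_def s_def)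
  qed
  have hs': "(\<Sum>i<n. \<Sum>j<n. (S' i j)\<^sup>2) = h + 2 * \<gamma> * u + \<beta>\<^sup>2 * u\<^sup>2"
  proof -
    have "(S' i j)\<^sup>2 = (S i j)\<^sup>2 + 2 * u * (S n i * S i j * S n j) + u\<^sup>2 * ((S n i)\<^sup>2 * (S n j)\<^sup>2)" for i j
      by (simp add: S'_def u_def power2_eq_square algebra_simps add_divide_distrib)
    then show ?thesis
      unfolding h_def \<gamma>_def \<beta>_def quad_form_def power2_eq_square[of "sum _ _"] sum_product
      by (simp add: sum.distrib sum_distrib_left[symmetric] mult.commute)
  qed
  have u: "0 \<le> u" "u \<le> 4 / 3" using s s1 by (auto simp: u_def field_simps)
  have key: "\<beta> * u / 2 + 2 * \<gamma> * u + \<beta>\<^sup>2 * u\<^sup>2 \<le> 2 * \<beta>"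
  proof -
    have 1: "\<gamma> * u \<le> \<beta> / 4 * u" using \<gamma> u by (intro mult_right_mono)
    have 2: "\<beta> * u \<le> \<beta> * (4 / 3)" using u \<beta>0 by (intro mult_left_mono)
    have "u\<^sup>2 \<le> (4 / 3)\<^sup>2" using u by (intro power_mono)
    moreover have "\<beta>\<^sup>2 \<le> \<beta> * (1 / 4)" using \<beta> \<beta>0 unfolding power2_eq_square by (intro mult_left_mono)
    ultimately have "\<beta>\<^sup>2 * u\<^sup>2 \<le> (\<beta> * (1 / 4)) * (4 / 3)\<^sup>2" using \<beta>0 by (intro mult_mono) auto
    then show ?thesis using 1 2 \<beta>0 by (simp add: power2_eq_square)
  qed
  have inner: "(\<integral>\<^sup>+z. ennreal (exp (quad_form (Suc n) S (x(n := z)) / 2)) \<partial>std_normal)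
      = ennreal (1 / sqrt (1 - s)) * ennreal (exp (quad_form n S' x / 2))" for x
  proof -
    have "exp (quad_form (Suc n) S (x(n := z)) / 2) = exp (quad_form n S x / 2) * exp (s / 2 * z\<^sup>2 + L x * z)" for z
      unfolding split exp_add[symmetric] by (simp add: algebra_simps add_divide_distrib)
    then have "(\<integral>\<^sup>+z. ennreal (exp (quad_form (Suc n) S (x(n := z)) / 2)) \<partial>std_normal)
        = ennreal (exp (quad_form n S x / 2)) * (\<integral>\<^sup>+z. ennreal (exp (s / 2 * z\<^sup>2 + L x * z)) \<partial>std_normal)"
      by (simp add: ennreal_mult nn_integral_cmult)
    also have "\<dots> = ennreal (exp (quad_form n S x / 2) * (exp ((L x)\<^sup>2 / (2 * (1 - s))) / sqrt (1 - s)))"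
      unfolding nn_integral_std_normal_exp_quadratic[OF s1(1)] using s1 by (simp add: ennreal_mult'[symmetric])
    also have "exp (quad_form n S x / 2) * (exp ((L x)\<^sup>2 / (2 * (1 - s))) / sqrt (1 - s))
        = 1 / sqrt (1 - s) * exp (quad_form n S' x / 2)"
    proof -
      have *: "quad_form n S' x / 2 = quad_form n S x / 2 + (L x)\<^sup>2 / (2 * (1 - s))"
        unfolding S' by (simp add: add_divide_distrib mult.commute)
      show ?thesis unfolding * exp_add by simp
    qed
    also have "ennreal (1 / sqrt (1 - s) * exp (quad_form n S' x / 2))
        = ennreal (1 / sqrt (1 - s)) * ennreal (exp (quad_form n S' x / 2))"
      using s1 by (intro ennreal_mult') simp
    finally show ?thesis .
  qed
  have meas: "(\<lambda>x. ennreal (exp (quad_form m A x / 2))) \<in> borel_measurable (Pi\<^sub>M {..<m} (\<lambda>_. std_normal))" for m A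
    by (intro measurable_compose[OF _ measurable_ennreal] borel_measurable_exp[THEN measurable_compose[rotated]]
        borel_measurable_divide measurable_quad_form measurable_PiM_component_real) auto
  have "(\<integral>\<^sup>+x. ennreal (exp (quad_form (Suc n) S x / 2)) \<partial>Pi\<^sub>M {..<Suc n} (\<lambda>_. std_normal))
      = (\<integral>\<^sup>+x. \<integral>\<^sup>+z. ennreal (exp (quad_form (Suc n) S (x(n := z)) / 2)) \<partial>std_normal \<partial>Pi\<^sub>M {..<n} (\<lambda>_. std_normal))"
    unfolding lessThan_Suc
    by (rule N.product_nn_integral_insert) (use meas[of "Suc n" S] in \<open>auto simp: lessThan_Suc\<close>)
  also have "\<dots> = ennreal (1 / sqrt (1 - s)) * (\<integral>\<^sup>+x. ennreal (exp (quad_form n S' x / 2)) \<partial>Pi\<^sub>M {..<n} (\<lambda>_. std_normal))"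
    unfolding inner by (rule nn_integral_cmult) (rule meas)
  also have "\<dots> \<le> ennreal (exp (s / 2 + s\<^sup>2)) * ennreal (exp ((\<Sum>i<n. S' i i) / 2 + (\<Sum>i<n. \<Sum>j<n. (S' i j)\<^sup>2)))"
    by (intro mult_mono ennreal_leI inverse_sqrt_le_exp s Suc.IH S'bnd)
      (auto simp: S'_def sym mult.commute)
  also have "\<dots> = ennreal (exp (s / 2 + s\<^sup>2 + ((\<Sum>i<n. S' i i) / 2 + (\<Sum>i<n. \<Sum>j<n. (S' i j)\<^sup>2))))"
    by (simp add: ennreal_mult exp_add)
  also have "\<dots> \<le> ennreal (exp ((\<Sum>i<Suc n. S i i) / 2 + (\<Sum>i<Suc n. \<Sum>j<Suc n. (S i j)\<^sup>2)))"
    unfolding hs hs' tr' using key by (intro ennreal_leI) (simp add: s_def add_divide_distrib)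
  finally show ?case .
qed

section \<open>Moment comparison for a single variable\<close>

abbreviation evens :: "nat \<Rightarrow> nat set" where
  "evens p \<equiv> {k. k \<le> p \<and> even k}"

text \<open>
  Integrated over a centered \<open>y\<close>, this replaces symmetrization by an independent copy: the last term
  vanishes and only even moments remain.
\<close>

lemma convex_power_average:
  fixes a y :: real
  assumes "even p"
  shows "(a + y) ^ p \<le> ((a + 2 * y) ^ p + (a - 2 * y) ^ p) / 2 + p * a ^ (p - 1) * y"
proof -
  have cvx: "convex_on UNIV (\<lambda>x::real. x ^ p)" by (rule convex_power_even) fact
  have eq: "(1 - 1 / 2) *\<^sub>R a + (1 / 2) *\<^sub>R (a + 2 * y) = a + y" by (simp add: field_simps)
  have "((1 - 1 / 2) *\<^sub>R a + (1 / 2) *\<^sub>R (a + 2 * y)) ^ p \<le> (1 - 1 / 2) * a ^ p + (1 / 2) * (a + 2 * y) ^ p"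
    by (rule convex_onD[OF cvx]) auto
  then have 1: "(a + y) ^ p \<le> a ^ p / 2 + (a + 2 * y) ^ p / 2" unfolding eq by simp
  have "(a - 2 * y) ^ p - a ^ p \<ge> (p * a ^ (p - 1)) * ((a - 2 * y) - a)"
    by (rule convex_on_imp_above_tangent[OF cvx]) (auto intro!: derivative_eq_intros)
  moreover have "(p * a ^ (p - 1)) * ((a - 2 * y) - a) = - 2 * (p * a ^ (p - 1) * y)"
    by (simp add: algebra_simps)
  ultimately show ?thesis using 1 by (simp add: add_divide_distrib)
qed

lemma power_average_even_part:
  fixes a y :: real
  shows "((a + y) ^ p + (a - y) ^ p) / 2 = (\<Sum>k\<in>evens p. (p choose k) * y ^ k * a ^ (p - k))"
proof -
  have "((a + y) ^ p + (a - y) ^ p) / 2 = (\<Sum>k\<le>p. if even k then (p choose k) * y ^ k * a ^ (p - k) else 0)"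
    using binomial_ring[of y a p] binomial_ring[of "- y" a p]
    by (auto simp: sum.distrib[symmetric] sum_divide_distrib add.commute intro!: sum.cong)
  also have "\<dots> = (\<Sum>k\<in>evens p. (p choose k) * y ^ k * a ^ (p - k))"
    by (subst sum.inter_filter[symmetric]) (auto simp: atMost_def intro!: sum.cong)
  finally show ?thesis .
qed

lemma nonneg_even_binomial_term:
  fixes a c :: real
  assumes "even p" "k \<in> evens p" "0 \<le> m"
  shows "0 \<le> (p choose k) * c ^ k * a ^ (p - k) * m"
  using assms by (auto intro!: mult_nonneg_nonneg zero_le_even_power)

lemma (in prob_space) nn_integral_affine_power_le:
  fixes X :: "'a \<Rightarrow> real" and a c :: real
  assumes "even p" "2 \<le> p"
    and int: "\<And>k. k \<le> p \<Longrightarrow> integrable M (\<lambda>\<omega>. X \<omega> ^ k)"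
    and zero: "expectation X = 0"
    and le: "\<And>k. 2 \<le> k \<Longrightarrow> k \<in> evens p \<Longrightarrow> 2 ^ k * expectation (\<lambda>\<omega>. X \<omega> ^ k) \<le> m k"
    and m0: "m 0 = 1"
  shows "(\<integral>\<^sup>+\<omega>. ennreal ((a + c * X \<omega>) ^ p) \<partial>M)
    \<le> ennreal (\<Sum>k\<in>evens p. (p choose k) * c ^ k * a ^ (p - k) * m k)"
proof -
  define g where "g \<omega> = (\<Sum>k\<in>evens p. (p choose k) * (2 * (c * X \<omega>)) ^ k * a ^ (p - k))
    + p * a ^ (p - 1) * (c * X \<omega>)" for \<omega>
  have pt: "(a + c * X \<omega>) ^ p \<le> g \<omega>" for \<omega>
    using convex_power_average[OF \<open>even p\<close>, of a "c * X \<omega>"]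
    unfolding power_average_even_part[of a "2 * (c * X \<omega>)"] g_def .
  have g: "g = (\<lambda>\<omega>. (\<Sum>k\<in>evens p. (p choose k) * c ^ k * a ^ (p - k) * (2 ^ k * X \<omega> ^ k))
    + p * a ^ (p - 1) * c * X \<omega>)"
    unfolding g_def by (simp add: power_mult_distrib mult_ac)
  have intX: "integrable M X" using int[of 1] assms(2) by simp
  have intg: "integrable M g"
    unfolding g by (intro Bochner_Integration.integrable_add Bochner_Integration.integrable_sum integrable_mult_right int intX) auto
  have "(\<integral>\<^sup>+\<omega>. ennreal ((a + c * X \<omega>) ^ p) \<partial>M) \<le> (\<integral>\<^sup>+\<omega>. ennreal (g \<omega>) \<partial>M)"
    by (intro nn_integral_mono ennreal_leI pt)
  also have "\<dots> = ennreal (expectation g)"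
    using order_trans[OF zero_le_even_power[OF \<open>even p\<close>] pt] by (intro nn_integral_eq_integral intg) auto
  also have "expectation g = (\<Sum>k\<in>evens p. (p choose k) * c ^ k * a ^ (p - k) * (2 ^ k * expectation (\<lambda>\<omega>. X \<omega> ^ k)))"
    unfolding g using zero int intX
    by (subst Bochner_Integration.integral_add, (auto)[2], subst Bochner_Integration.integral_sum, auto)
  also have "\<dots> \<le> (\<Sum>k\<in>evens p. (p choose k) * c ^ k * a ^ (p - k) * m k)"
  proof (rule sum_mono)
    fix k assume k: "k \<in> evens p"
    have "2 ^ k * expectation (\<lambda>\<omega>. X \<omega> ^ k) \<le> m k"
    proof (cases "k = 0")
      case True
      then show ?thesis using m0 by (simp add: prob_space)
    next
      case False
      then have "k \<noteq> 1" "k \<noteq> 0" using k by auto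
      then show ?thesis using le[OF _ k] by linarith
    qed
    moreover have "0 \<le> (p choose k) * c ^ k * a ^ (p - k) * 1"
      by (rule nonneg_even_binomial_term[OF \<open>even p\<close> k]) simp
    ultimately show "(p choose k) * c ^ k * a ^ (p - k) * (2 ^ k * expectation (\<lambda>\<omega>. X \<omega> ^ k))
        \<le> (p choose k) * c ^ k * a ^ (p - k) * m k"
      by (intro mult_left_mono) simp_all
  qed
  finally show ?thesis by (simp add: ennreal_leI)
qed

definition sparse_moment :: "real \<Rightarrow> real \<Rightarrow> nat \<Rightarrow> real" where
  "sparse_moment q b k = (if k = 0 then 1 else q * b ^ k * normal_moment k)"

lemma normal_moment_0 [simp]: "normal_moment 0 = 1"
  by (simp add: normal_moment_def)

lemma sparse_moment_nonneg: "0 \<le> q \<Longrightarrow> even k \<Longrightarrow> 0 \<le> sparse_moment q b k"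
  by (simp add: sparse_moment_def normal_moment_nonneg zero_le_even_power)

lemma nn_integral_std_normal_affine_power:
  fixes a c :: real
  assumes "even p"
  shows "(\<integral>\<^sup>+z. ennreal ((a + c * z) ^ p) \<partial>std_normal)
    = ennreal (\<Sum>k\<in>evens p. (p choose k) * c ^ k * a ^ (p - k) * normal_moment k)"
proof -
  have e: "(\<lambda>z. (a + c * z) ^ p) = (\<lambda>z. \<Sum>k\<le>p. (p choose k) * c ^ k * a ^ (p - k) * z ^ k)"
    using binomial_ring[of "c * _" a p] by (simp add: power_mult_distrib mult_ac add.commute)
  have "integrable std_normal (\<lambda>z. (a + c * z) ^ p)"
    unfolding e by (intro Bochner_Integration.integrable_sum integrable_mult_right std_normal_moment)
  then have "(\<integral>\<^sup>+z. ennreal ((a + c * z) ^ p) \<partial>std_normal) = ennreal (\<integral>z. (a + c * z) ^ p \<partial>std_normal)"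
    using assms by (intro nn_integral_eq_integral) (auto simp: zero_le_even_power)
  also have "(\<integral>z. (a + c * z) ^ p \<partial>std_normal) = (\<Sum>k\<le>p. (p choose k) * c ^ k * a ^ (p - k) * normal_moment k)"
    unfolding e by (subst Bochner_Integration.integral_sum)
      (auto simp: std_normal_moment intro!: integrable_mult_right)
  also have "\<dots> = (\<Sum>k\<in>evens p. (p choose k) * c ^ k * a ^ (p - k) * normal_moment k)"
    by (intro sum.mono_neutral_right) (auto simp: normal_moment_def)
  finally show ?thesis .
qed

lemma sum_evens_sparse:
  fixes h :: "nat \<Rightarrow> real"
  shows "(1 - q) * h 0 + q * (\<Sum>k\<in>evens p. h k * (b ^ k * normal_moment k))
    = (\<Sum>k\<in>evens p. h k * sparse_moment q b k)"
proof -
  have 1: "(\<Sum>k\<in>evens p. f k) = f 0 + (\<Sum>k\<in>evens p - {0}. f k)" for f :: "nat \<Rightarrow> real"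
    by (rule sum.remove) auto
  have 2: "q * (\<Sum>k\<in>evens p - {0}. h k * (b ^ k * normal_moment k))
    = (\<Sum>k\<in>evens p - {0}. h k * sparse_moment q b k)"
    unfolding sum_distrib_left by (intro sum.cong) (auto simp: sparse_moment_def)
  show ?thesis
    unfolding 1[of "\<lambda>k. h k * (b ^ k * normal_moment k)"] 1[of "\<lambda>k. h k * sparse_moment q b k"] 2[symmetric]
    by (simp add: algebra_simps sparse_moment_def)
qed

lemma nn_integral_sparse_normal_affine_power:
  fixes a c q b :: real
  assumes "even p" "0 \<le> q" "q \<le> 1"
  shows "(\<integral>\<^sup>+y. ennreal ((a + c * y) ^ p) \<partial>sparse_normal q b)
    = ennreal (\<Sum>k\<in>evens p. (p choose k) * c ^ k * a ^ (p - k) * sparse_moment q b k)"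
proof -
  define h where "h k = (p choose k) * c ^ k * a ^ (p - k)" for k
  have h: "0 \<le> h k" if "k \<in> evens p" for k
    using nonneg_even_binomial_term[OF assms(1) that, of 1 c a] by (simp add: h_def)
  have "(\<integral>\<^sup>+y. ennreal ((a + c * y) ^ p) \<partial>sparse_normal q b)
      = ennreal (1 - q) * ennreal (a ^ p) + ennreal q * (\<integral>\<^sup>+z. ennreal ((a + (c * b) * z) ^ p) \<partial>std_normal)"
    using assms by (subst nn_integral_sparse_normal) (auto simp: mult.assoc)
  also have "\<dots> = ennreal ((1 - q) * h 0 + q * (\<Sum>k\<in>evens p. h k * (b ^ k * normal_moment k)))"
  proof -
    have "(\<Sum>k\<in>evens p. (p choose k) * (c * b) ^ k * a ^ (p - k) * normal_moment k)
      = (\<Sum>k\<in>evens p. h k * (b ^ k * normal_moment k))"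
      by (simp add: h_def power_mult_distrib mult_ac)
    moreover have "0 \<le> (\<Sum>k\<in>evens p. h k * (b ^ k * normal_moment k))"
      by (intro sum_nonneg mult_nonneg_nonneg h normal_moment_nonneg) (auto simp: zero_le_even_power)
    ultimately show ?thesis
      unfolding nn_integral_std_normal_affine_power[OF assms(1)] using assms
      by (simp add: h_def ennreal_mult'[symmetric] ennreal_plus[symmetric] zero_le_even_power del: ennreal_plus)
  qed
  finally show ?thesis unfolding sum_evens_sparse by (simp add: h_def)
qed

lemma nn_integral_sparse_normal_even_polynomial:
  assumes "0 \<le> q" "q \<le> 1" and h: "\<And>k. k \<in> evens p \<Longrightarrow> 0 \<le> h k"
  shows "(\<integral>\<^sup>+y. ennreal (\<Sum>k\<in>evens p. h k * y ^ k) \<partial>sparse_normal q b)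
    = ennreal (\<Sum>k\<in>evens p. h k * sparse_moment q b k)"
proof -
  have "(\<integral>\<^sup>+z. ennreal (\<Sum>k\<in>evens p. h k * (b * z) ^ k) \<partial>std_normal)
      = ennreal (\<integral>z. (\<Sum>k\<in>evens p. h k * (b * z) ^ k) \<partial>std_normal)"
    unfolding power_mult_distrib mult.assoc[symmetric]
    by (intro nn_integral_eq_integral Bochner_Integration.integrable_sum integrable_mult_right std_normal_moment)
      (auto intro!: sum_nonneg mult_nonneg_nonneg h simp: zero_le_even_power power_mult_distrib[symmetric] mult.assoc)
  also have "(\<integral>z. (\<Sum>k\<in>evens p. h k * (b * z) ^ k) \<partial>std_normal)
      = (\<Sum>k\<in>evens p. h k * (b ^ k * normal_moment k))"
    unfolding power_mult_distrib mult.assoc[symmetric]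
    by (subst Bochner_Integration.integral_sum) (auto simp: std_normal_moment intro!: integrable_mult_right)
  finally have N: "(\<integral>\<^sup>+z. ennreal (\<Sum>k\<in>evens p. h k * (b * z) ^ k) \<partial>std_normal)
      = ennreal (\<Sum>k\<in>evens p. h k * (b ^ k * normal_moment k))" .
  have z: "(\<Sum>k\<in>evens p. h k * 0 ^ k) = h 0"
    by (subst sum.remove[of _ 0]) (auto intro!: sum.neutral)
  have "(\<integral>\<^sup>+y. ennreal (\<Sum>k\<in>evens p. h k * y ^ k) \<partial>sparse_normal q b)
      = ennreal (1 - q) * ennreal (h 0) + ennreal q * ennreal (\<Sum>k\<in>evens p. h k * (b ^ k * normal_moment k))"
    using assms(1,2) by (subst nn_integral_sparse_normal) (auto simp: N z)
  also have "\<dots> = ennreal ((1 - q) * h 0 + q * (\<Sum>k\<in>evens p. h k * (b ^ k * normal_moment k)))"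
  proof -
    have "0 \<le> (\<Sum>k\<in>evens p. h k * (b ^ k * normal_moment k))"
      by (intro sum_nonneg mult_nonneg_nonneg h normal_moment_nonneg) (auto simp: zero_le_even_power)
    then show ?thesis
      using assms h[of 0] by (simp add: ennreal_mult'[symmetric] ennreal_plus[symmetric] del: ennreal_plus)
  qed
  finally show ?thesis unfolding sum_evens_sparse .
qed

definition sparse_product :: "real \<Rightarrow> real \<Rightarrow> real measure" where
  "sparse_product q b = distr (sparse_normal q b \<Otimes>\<^sub>M sparse_normal q b) borel (\<lambda>(x, y). x * y)"

lemma sets_sparse_product [simp, measurable_cong]: "sets (sparse_product q b) = sets borel"
  and space_sparse_product [simp]: "space (sparse_product q b) = UNIV"
  by (simp_all add: sparse_product_def)

lemma prob_space_sparse_product: "prob_space (sparse_product q b)"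
proof -
  interpret S: prob_space "sparse_normal q b" by (rule prob_space_sparse_normal)
  interpret pair_prob_space "sparse_normal q b" "sparse_normal q b" ..
  show ?thesis unfolding sparse_product_def by (rule prob_space_distr) measurable
qed

lemma nn_integral_sparse_product:
  assumes [measurable]: "F \<in> borel_measurable borel"
  shows "(\<integral>\<^sup>+w. F w \<partial>sparse_product q b)
    = (\<integral>\<^sup>+x. \<integral>\<^sup>+y. F (x * y) \<partial>sparse_normal q b \<partial>sparse_normal q b)"
proof -
  interpret S: prob_space "sparse_normal q b" by (rule prob_space_sparse_normal)
  show ?thesis unfolding sparse_product_def
    by (subst nn_integral_distr, simp, simp, subst S.nn_integral_fst[symmetric])
      (auto simp: case_prod_beta)
qed

lemma nn_integral_sparse_product_affine_power:
  fixes a c q b :: real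
  assumes "even p" "0 \<le> q" "q \<le> 1"
  shows "(\<integral>\<^sup>+w. ennreal ((a + c * w) ^ p) \<partial>sparse_product q b)
    = ennreal (\<Sum>k\<in>evens p. (p choose k) * c ^ k * a ^ (p - k) * (sparse_moment q b k)\<^sup>2)"
proof -
  have "(\<integral>\<^sup>+w. ennreal ((a + c * w) ^ p) \<partial>sparse_product q b)
    = (\<integral>\<^sup>+x. \<integral>\<^sup>+y. ennreal ((a + (c * x) * y) ^ p) \<partial>sparse_normal q b \<partial>sparse_normal q b)"
    by (subst nn_integral_sparse_product) (auto simp: mult.assoc)
  also have "\<dots> = (\<integral>\<^sup>+x. ennreal (\<Sum>k\<in>evens p. ((p choose k) * c ^ k * a ^ (p - k) * sparse_moment q b k) * x ^ k) \<partial>sparse_normal q b)"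
    unfolding nn_integral_sparse_normal_affine_power[OF assms]
    by (intro nn_integral_cong arg_cong[where f = ennreal] sum.cong refl) (simp add: power_mult_distrib mult_ac)
  also have "\<dots> = ennreal (\<Sum>k\<in>evens p. ((p choose k) * c ^ k * a ^ (p - k) * sparse_moment q b k) * sparse_moment q b k)"
    using assms by (intro nn_integral_sparse_normal_even_polynomial nonneg_even_binomial_term sparse_moment_nonneg) auto
  finally show ?thesis by (simp add: power2_eq_square mult.assoc)
qed

section \<open>Sparse chaos\<close>

lemma power_le_fact_exp:
  fixes x :: real
  assumes "0 \<le> x"
  shows "x ^ p \<le> fact p * exp x"
proof -
  have "(\<lambda>k. x ^ k /\<^sub>R fact k) sums exp x" by (rule exp_converges)
  then have "x ^ p /\<^sub>R fact p \<le> exp x"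
    using sum_le_suminf[of "\<lambda>k. x ^ k /\<^sub>R fact k" "{p}"] assms by (simp add: sums_iff)
  then show ?thesis by (simp add: field_simps)
qed

lemma nn_integral_power_le_exp_moment:
  fixes f :: "'a \<Rightarrow> real"
  assumes [measurable]: "f \<in> borel_measurable N" and "even p" "1 \<le> p" "0 < \<Lambda>"
    and "(\<integral>\<^sup>+x. ennreal (exp (1 / \<Lambda> * f x)) \<partial>N) \<le> ennreal (exp (16 * real p))"
    and "(\<integral>\<^sup>+x. ennreal (exp (- (1 / \<Lambda>) * f x)) \<partial>N) \<le> ennreal (exp (16 * real p))"
  shows "(\<integral>\<^sup>+x. ennreal (f x ^ p) \<partial>N) \<le> ennreal ((2 * exp 16 * (p * \<Lambda>)) ^ p)"
proof -
  have pt: "f x ^ p \<le> (p * \<Lambda>) ^ p * (exp (1 / \<Lambda> * f x) + exp (- (1 / \<Lambda>) * f x))" for x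
  proof -
    have "(\<bar>f x\<bar> / \<Lambda>) ^ p \<le> fact p * exp (\<bar>f x\<bar> / \<Lambda>)"
      using assms by (intro power_le_fact_exp) simp
    also have "\<dots> \<le> real p ^ p * (exp (1 / \<Lambda> * f x) + exp (- (1 / \<Lambda>) * f x))"
      using fact_le_power[of p] by (intro mult_mono) (auto simp: abs_if)
    finally have "\<Lambda> ^ p * (\<bar>f x\<bar> / \<Lambda>) ^ p
        \<le> \<Lambda> ^ p * (real p ^ p * (exp (1 / \<Lambda> * f x) + exp (- (1 / \<Lambda>) * f x)))"
      using assms(4) by (intro mult_left_mono) auto
    moreover have "\<Lambda> ^ p * (\<bar>f x\<bar> / \<Lambda>) ^ p = f x ^ p"
      using assms(2,4) by (simp add: power_mult_distrib[symmetric] power_even_abs)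
    ultimately show ?thesis by (simp add: power_mult_distrib mult_ac)
  qed
  have "(\<integral>\<^sup>+x. ennreal (f x ^ p) \<partial>N)
      \<le> (\<integral>\<^sup>+x. ennreal ((p * \<Lambda>) ^ p) * (ennreal (exp (1 / \<Lambda> * f x)) + ennreal (exp (- (1 / \<Lambda>) * f x))) \<partial>N)"
    using pt assms(4)
    by (intro nn_integral_mono) (simp add: ennreal_mult'[symmetric] ennreal_plus[symmetric] ennreal_leI del: ennreal_plus)
  also have "\<dots> = ennreal ((p * \<Lambda>) ^ p) * ((\<integral>\<^sup>+x. ennreal (exp (1 / \<Lambda> * f x)) \<partial>N) + (\<integral>\<^sup>+x. ennreal (exp (- (1 / \<Lambda>) * f x)) \<partial>N))"
    by (subst nn_integral_cmult, measurable, subst nn_integral_add, measurable)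
  also have "\<dots> \<le> ennreal ((p * \<Lambda>) ^ p) * (ennreal (exp (16 * real p)) + ennreal (exp (16 * real p)))"
    by (intro mult_left_mono add_mono assms) auto
  also have "\<dots> = ennreal ((p * \<Lambda>) ^ p * (2 * exp (16 * real p)))"
    using assms(4) by (simp add: ennreal_mult'[symmetric] ennreal_plus[symmetric] del: ennreal_plus)
  also have "\<dots> \<le> ennreal ((2 * exp 16 * (p * \<Lambda>)) ^ p)"
  proof (rule ennreal_leI)
    have "(2::real) ^ 1 \<le> 2 ^ p" using assms(3) by (intro power_increasing) auto
    then have "(p * \<Lambda>) ^ p * (2 * exp (16 * real p)) \<le> (p * \<Lambda>) ^ p * (2 ^ p * exp (16 * real p))"
      using assms(4) by (intro mult_left_mono mult_right_mono) auto
    also have "(p * \<Lambda>) ^ p * (2 ^ p * exp (16 * real p)) = (2 * exp 16 * (p * \<Lambda>)) ^ p"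
    proof -
      have "exp (16 * real p) = exp 16 ^ p" by (simp add: exp_of_nat_mult[symmetric] mult.commute)
      then show ?thesis by (simp only: power_mult_distrib mult_ac)
    qed
    finally show "(p * \<Lambda>) ^ p * (2 * exp (16 * real p)) \<le> (2 * exp 16 * (p * \<Lambda>)) ^ p" .
  qed
  finally show ?thesis .
qed

lemma measurable_quad_form_PiM_UNIV:
  "quad_form n A \<in> borel_measurable (Pi\<^sub>M UNIV (\<lambda>_. borel))"
  by (rule measurable_quad_form) simp

lemma sparse_chaos_exp_moment:
  fixes A :: "nat \<Rightarrow> nat \<Rightarrow> real"
  assumes q: "0 \<le> q" "q \<le> 1"
    and A: "\<And>i j. A i j = A j i" "\<And>i. A i i = 0"
    and \<kappa>: "\<And>x. \<bar>quad_form n A x\<bar> \<le> \<kappa> * (\<Sum>i<n. (x i)\<^sup>2)" "\<And>i. i < n \<Longrightarrow> (\<Sum>j<n. (A i j)\<^sup>2) \<le> \<kappa>\<^sup>2" "0 \<le> \<kappa>"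
    and l: "8 * \<bar>l\<bar> * b\<^sup>2 * \<kappa> \<le> 1"
  shows "(\<integral>\<^sup>+y. ennreal (exp (l * quad_form n A y)) \<partial>Pi\<^sub>M {..<n} (\<lambda>_. sparse_normal q b))
    \<le> ennreal (exp (16 * l\<^sup>2 * (q * b\<^sup>2)\<^sup>2 * (\<Sum>i<n. \<Sum>j<n. (A i j)\<^sup>2)))"
proof -
  define w where "w i j = 4 * l\<^sup>2 * b ^ 4 * (A i j)\<^sup>2" for i j
  have "(\<integral>\<^sup>+y. ennreal (exp (l * quad_form n A y)) \<partial>Pi\<^sub>M {..<n} (\<lambda>_. sparse_normal q b))
    = bernoulli_mean q n (\<lambda>d. \<integral>\<^sup>+x. ennreal (exp (l * quad_form n A (\<lambda>i. d i * (b * x i)))) \<partial>Pi\<^sub>M {..<n} (\<lambda>_. std_normal))"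
  proof (rule nn_integral_PiM_sparse_normal[OF q])
    have [measurable]: "quad_form n A \<in> borel_measurable (Pi\<^sub>M UNIV (\<lambda>_. borel))"
      by (rule measurable_quad_form_PiM_UNIV)
    show "(\<lambda>x. ennreal (exp (l * quad_form n A x))) \<in> borel_measurable (Pi\<^sub>M UNIV (\<lambda>_. borel))"
      by measurable
  next
    fix x y :: "nat \<Rightarrow> real" assume "\<And>i. i < n \<Longrightarrow> x i = y i"
    then show "ennreal (exp (l * quad_form n A x)) = ennreal (exp (l * quad_form n A y))"
      using quad_form_cong[of n x y A] by simp
  qed
  also have "\<dots> \<le> bernoulli_mean q n (\<lambda>d. ennreal (exp ((\<Sum>i<n. \<Sum>j<n. w i j * d i * d j) + (\<Sum>i<n. 0 * d i))))"
  proof (rule bernoulli_mean_mono)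
    fix d :: "nat \<Rightarrow> real" assume "range d \<subseteq> {0, 1}"
    then have d: "d i = 0 \<or> d i = 1" for i by auto
    have d2: "(d i)\<^sup>2 = d i" for i by (rule disjE[OF d[of i]]) simp_all
    have d2': "(d i)\<^sup>2 \<le> 1" for i by (rule disjE[OF d[of i]]) simp_all
    define S where "S i j = 2 * l * b\<^sup>2 * (d i * A i j * d j)" for i j
    have S: "quad_form n S x = 2 * l * b\<^sup>2 * quad_form n A (\<lambda>i. d i * x i)" for x
      by (simp add: quad_form_def S_def sum_distrib_left mult_ac)
    have "quad_form n S x / 2 = l * quad_form n A (\<lambda>i. d i * (b * x i))" for x
      unfolding S by (simp add: quad_form_def sum_distrib_left mult_ac power2_eq_square)
    then have "(\<integral>\<^sup>+x. ennreal (exp (l * quad_form n A (\<lambda>i. d i * (b * x i)))) \<partial>Pi\<^sub>M {..<n} (\<lambda>_. std_normal))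
      = (\<integral>\<^sup>+x. ennreal (exp (quad_form n S x / 2)) \<partial>Pi\<^sub>M {..<n} (\<lambda>_. std_normal))"
      by simp
    also have "\<dots> \<le> ennreal (exp ((\<Sum>i<n. S i i) / 2 + (\<Sum>i<n. \<Sum>j<n. (S i j)\<^sup>2)))"
    proof (rule gaussian_exp_quad_form)
      show "S i j = S j i" for i j by (simp add: S_def A(1)[of i j])
    next
      fix x
      have "\<bar>quad_form n S x\<bar> = 2 * \<bar>l\<bar> * b\<^sup>2 * \<bar>quad_form n A (\<lambda>i. d i * x i)\<bar>"
        by (simp add: S abs_mult)
      also have "\<dots> \<le> 2 * \<bar>l\<bar> * b\<^sup>2 * (\<kappa> * (\<Sum>i<n. (d i * x i)\<^sup>2))"
        by (intro mult_left_mono \<kappa>) auto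
      also have "\<dots> \<le> 2 * \<bar>l\<bar> * b\<^sup>2 * (\<kappa> * (\<Sum>i<n. (x i)\<^sup>2))"
        using d2' \<kappa>(3)
        by (intro mult_left_mono sum_mono) (auto simp: power_mult_distrib mult_left_le_one_le)
      also have "\<dots> = (8 * \<bar>l\<bar> * b\<^sup>2 * \<kappa>) * ((\<Sum>i<n. (x i)\<^sup>2) / 4)" by simp
      also have "\<dots> \<le> 1 * ((\<Sum>i<n. (x i)\<^sup>2) / 4)"
        by (intro mult_right_mono l) (auto intro: sum_nonneg)
      finally show "\<bar>quad_form n S x\<bar> \<le> (\<Sum>i<n. (x i)\<^sup>2) / 4" by simp
    qed
    also have "(\<Sum>i<n. S i i) / 2 + (\<Sum>i<n. \<Sum>j<n. (S i j)\<^sup>2)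
        = (\<Sum>i<n. \<Sum>j<n. w i j * d i * d j) + (\<Sum>i<n. 0 * d i)"
    proof -
      have "(S i j)\<^sup>2 = w i j * (d i)\<^sup>2 * (d j)\<^sup>2" for i j
        by (simp add: S_def w_def power_mult_distrib mult_ac power_mult[symmetric])
      then have "(S i j)\<^sup>2 = w i j * d i * d j" for i j by (simp only: d2)
      moreover have "S i i = 0" for i by (simp add: S_def A)
      ultimately show ?thesis by simp
    qed
    finally show "(\<integral>\<^sup>+x. ennreal (exp (l * quad_form n A (\<lambda>i. d i * (b * x i)))) \<partial>Pi\<^sub>M {..<n} (\<lambda>_. std_normal))
      \<le> ennreal (exp ((\<Sum>i<n. \<Sum>j<n. w i j * d i * d j) + (\<Sum>i<n. 0 * d i)))"
      .
  qed
  also have "\<dots> \<le> ennreal (exp (2 * q * (\<Sum>i<n. 0) + 4 * q\<^sup>2 * (\<Sum>i<n. \<Sum>j<n. w i j)))"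
  proof (rule bernoulli_mean_exp_quadratic[OF q])
    show "0 \<le> w i j" for i j by (simp add: w_def)
    show "w i j = w j i" for i j by (simp add: w_def A(1)[of i j])
    show "w i i = 0" for i by (simp add: w_def A(2))
    fix i assume "i < n"
    have "4 * (\<Sum>j<n. w i j) = 16 * l\<^sup>2 * b ^ 4 * (\<Sum>j<n. (A i j)\<^sup>2)"
      by (simp add: w_def sum_distrib_left mult.assoc)
    also have "\<dots> \<le> 16 * l\<^sup>2 * b ^ 4 * \<kappa>\<^sup>2"
      by (intro mult_left_mono \<kappa>(2)[OF \<open>i < n\<close>]) auto
    also have "\<dots> = (8 * \<bar>l\<bar> * b\<^sup>2 * \<kappa>)\<^sup>2 / 4"
      by (simp add: power_mult_distrib power_mult[symmetric])
    also have "\<dots> \<le> 1"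
    proof -
      have "(8 * \<bar>l\<bar> * b\<^sup>2 * \<kappa>)\<^sup>2 \<le> 1\<^sup>2" using l \<kappa>(3) by (intro power_mono) auto
      then show ?thesis by simp
    qed
    finally show "0 + 4 * (\<Sum>j<n. w i j) \<le> 1" by simp
  qed simp
  also have "2 * q * (\<Sum>i<n. 0) + 4 * q\<^sup>2 * (\<Sum>i<n. \<Sum>j<n. w i j)
      = 16 * l\<^sup>2 * (q * b\<^sup>2)\<^sup>2 * (\<Sum>i<n. \<Sum>j<n. (A i j)\<^sup>2)"
    by (simp add: w_def sum_distrib_left power_mult_distrib power_mult[symmetric] mult_ac)
  finally show ?thesis .
qed

lemma inverse_sqrt_le_linear:
  assumes "0 \<le> u" "u \<le> 1 / 2"
  shows "1 / sqrt (1 - u) \<le> 1 + u"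
proof -
  have "u * u \<le> u * (1 / 2)" "u * u * u \<le> u * u * (1 / 2)"
    using assms by (intro mult_left_mono; simp)+
  then have "1 \<le> (1 - u) * (1 + u)\<^sup>2" using assms by (simp add: power2_eq_square algebra_simps)
  then have "1 \<le> sqrt ((1 - u) * (1 + u)\<^sup>2)" by simp
  also have "\<dots> = sqrt (1 - u) * (1 + u)" using assms by (simp add: real_sqrt_mult)
  finally show ?thesis using assms by (simp add: field_simps)
qed

lemma sparse_product_exp_moment:
  assumes q: "0 \<le> q" "q \<le> 1" and \<theta>: "\<theta>\<^sup>2 * b ^ 4 \<le> 1 / 2"
  shows "(\<integral>\<^sup>+w. ennreal (exp (\<theta> * w)) \<partial>sparse_product q b) \<le> ennreal (exp (\<theta>\<^sup>2 * (q * b\<^sup>2)\<^sup>2))"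
proof -
  define u where "u = \<theta>\<^sup>2 * b ^ 4"
  have u: "0 \<le> u" "u \<le> 1 / 2" using \<theta> by (auto simp: u_def)
  have lin: "(\<integral>\<^sup>+z. ennreal (exp (c * z)) \<partial>std_normal) = ennreal (exp (c\<^sup>2 / 2))" for c
    using nn_integral_std_normal_exp_quadratic[of 0 c] by simp
  have 1: "(\<integral>\<^sup>+y. ennreal (exp (\<theta> * (x * y))) \<partial>sparse_normal q b)
      = ennreal (1 - q) + ennreal q * ennreal (exp ((\<theta> * x * b)\<^sup>2 / 2))" for x
    using q lin[of "\<theta> * x * b"] by (subst nn_integral_sparse_normal) (auto simp: mult.assoc)
  have 2: "(\<integral>\<^sup>+x. ennreal (exp ((\<theta> * x * b)\<^sup>2 / 2)) \<partial>sparse_normal q b)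
      = ennreal (1 - q) + ennreal q * ennreal (1 / sqrt (1 - u))"
  proof -
    have *: "exp ((\<theta> * (b * z) * b)\<^sup>2 / 2) = exp (u / 2 * z\<^sup>2 + 0 * z)" for z
      by (simp add: u_def power2_eq_square power4_eq_xxxx mult_ac)
    show ?thesis
      using q u nn_integral_std_normal_exp_quadratic[of u 0]
      by (subst nn_integral_sparse_normal) (auto simp only: *, simp_all)
  qed
  have s1: "emeasure (sparse_normal q b) UNIV = 1"
    using prob_space.emeasure_space_1[OF prob_space_sparse_normal[of q b]] by simp
  have "(\<integral>\<^sup>+w. ennreal (exp (\<theta> * w)) \<partial>sparse_product q b)
      = ennreal (1 - q) + ennreal q * (ennreal (1 - q) + ennreal q * ennreal (1 / sqrt (1 - u)))"
    by (subst nn_integral_sparse_product)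
      (auto simp: 1 2 nn_integral_add nn_integral_cmult s1 simp del: ennreal_plus)
  also have "\<dots> = ennreal (1 - q + q * (1 - q + q * (1 / sqrt (1 - u))))"
    using q u by (simp add: ennreal_mult'[symmetric] ennreal_plus[symmetric] del: ennreal_plus)
  also have "\<dots> \<le> ennreal (exp (\<theta>\<^sup>2 * (q * b\<^sup>2)\<^sup>2))"
  proof (rule ennreal_leI)
    have "1 - q + q * (1 - q + q * (1 / sqrt (1 - u))) \<le> 1 - q + q * (1 - q + q * (1 + u))"
      using q inverse_sqrt_le_linear[OF u] by (intro add_left_mono mult_left_mono) auto
    also have "\<dots> = 1 + \<theta>\<^sup>2 * (q * b\<^sup>2)\<^sup>2"
      by (simp add: u_def power2_eq_square power4_eq_xxxx algebra_simps)
    also have "\<dots> \<le> exp (\<theta>\<^sup>2 * (q * b\<^sup>2)\<^sup>2)" by (rule exp_ge_add_one_self)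
    finally show "1 - q + q * (1 - q + q * (1 / sqrt (1 - u))) \<le> exp (\<theta>\<^sup>2 * (q * b\<^sup>2)\<^sup>2)" .
  qed
  finally show ?thesis .
qed

lemma sparse_product_sum_exp_moment:
  fixes a :: "nat \<Rightarrow> real"
  assumes q: "0 \<le> q" "q \<le> 1" and "\<And>i. i < n \<Longrightarrow> (l * a i)\<^sup>2 * b ^ 4 \<le> 1 / 2"
  shows "(\<integral>\<^sup>+w. ennreal (exp (l * (\<Sum>i<n. a i * w i))) \<partial>Pi\<^sub>M {..<n} (\<lambda>_. sparse_product q b))
    \<le> ennreal (exp (l\<^sup>2 * (q * b\<^sup>2)\<^sup>2 * (\<Sum>i<n. (a i)\<^sup>2)))"
proof -
  interpret product_sigma_finite "\<lambda>_::nat. sparse_product q b"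
    by (rule product_sigma_finite_prob) (rule prob_space_sparse_product)
  have "(\<integral>\<^sup>+w. ennreal (exp (l * (\<Sum>i<n. a i * w i))) \<partial>Pi\<^sub>M {..<n} (\<lambda>_. sparse_product q b))
      = (\<integral>\<^sup>+w. (\<Prod>i<n. ennreal (exp (l * a i * w i))) \<partial>Pi\<^sub>M {..<n} (\<lambda>_. sparse_product q b))"
  proof -
    have "exp (l * (\<Sum>i<n. a i * w i)) = (\<Prod>i<n. exp (l * a i * w i))" for w
      unfolding sum_distrib_left by (subst exp_sum[symmetric]) (auto simp: mult.assoc)
    then show ?thesis by (simp add: prod_ennreal)
  qed
  also have "\<dots> = (\<Prod>i<n. \<integral>\<^sup>+w. ennreal (exp (l * a i * w)) \<partial>sparse_product q b)"
    by (rule product_nn_integral_prod) auto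
  also have "\<dots> \<le> (\<Prod>i<n. ennreal (exp ((l * a i)\<^sup>2 * (q * b\<^sup>2)\<^sup>2)))"
    by (intro prod_mono_ennreal sparse_product_exp_moment q assms) auto
  also have "\<dots> = ennreal (exp (l\<^sup>2 * (q * b\<^sup>2)\<^sup>2 * (\<Sum>i<n. (a i)\<^sup>2)))"
  proof -
    have "(\<Prod>i<n. exp ((l * a i)\<^sup>2 * (q * b\<^sup>2)\<^sup>2)) = exp (l\<^sup>2 * (q * b\<^sup>2)\<^sup>2 * (\<Sum>i<n. (a i)\<^sup>2))"
      by (subst exp_sum[symmetric]) (auto simp: sum_distrib_left power_mult_distrib mult_ac)
    then show ?thesis by (simp add: prod_ennreal)
  qed
  finally show ?thesis .
qed

lemma chaos_scale:
  fixes b \<kappa> v h p :: real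
  assumes "0 < v" "0 < h" "0 \<le> \<kappa>" "1 \<le> p"
  defines "\<Lambda> \<equiv> 8 * b\<^sup>2 * \<kappa> + v * h / sqrt p"
  shows "0 < \<Lambda>" "8 * (1 / \<Lambda>) * b\<^sup>2 * \<kappa> \<le> 1" "16 * (1 / \<Lambda>)\<^sup>2 * v\<^sup>2 * h\<^sup>2 \<le> 16 * p"
    "p * \<Lambda> = 8 * b\<^sup>2 * \<kappa> * p + v * h * sqrt p"
proof -
  have sp: "0 < sqrt p" "sqrt p * sqrt p = p" using assms by auto
  have pos: "0 < v * h / sqrt p" "0 \<le> 8 * b\<^sup>2 * \<kappa>" using assms sp by auto
  show \<Lambda>: "0 < \<Lambda>" unfolding \<Lambda>_def by (rule add_nonneg_pos[OF pos(2,1)])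
  have "8 * b\<^sup>2 * \<kappa> \<le> \<Lambda>" using pos by (simp add: \<Lambda>_def)
  then show "8 * (1 / \<Lambda>) * b\<^sup>2 * \<kappa> \<le> 1" using \<Lambda> by (simp add: field_simps)
  have "v * h / sqrt p \<le> \<Lambda>" using pos by (simp add: \<Lambda>_def)
  then have "v * h \<le> \<Lambda> * sqrt p" using sp by (simp add: field_simps)
  then have "(v * h)\<^sup>2 \<le> (\<Lambda> * sqrt p)\<^sup>2" using assms by (intro power_mono) auto
  then have "(v * h)\<^sup>2 \<le> \<Lambda>\<^sup>2 * p" using assms by (simp add: power_mult_distrib)
  then show "16 * (1 / \<Lambda>)\<^sup>2 * v\<^sup>2 * h\<^sup>2 \<le> 16 * p"
    using \<Lambda> by (simp add: field_simps power_mult_distrib)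
  have "p * (v * h / sqrt p) = v * h * sqrt p" using sp by (simp add: field_simps)
  then show "p * \<Lambda> = 8 * b\<^sup>2 * \<kappa> * p + v * h * sqrt p" by (simp add: \<Lambda>_def algebra_simps)
qed

lemma sparse_chaos_moment:
  fixes A :: "nat \<Rightarrow> nat \<Rightarrow> real"
  assumes q: "0 \<le> q" "q \<le> 1" "0 < q * b\<^sup>2" and p: "even p" "1 \<le> p"
    and A: "\<And>i j. A i j = A j i" "\<And>i. A i i = 0"
    and \<kappa>: "\<And>x. \<bar>quad_form n A x\<bar> \<le> \<kappa> * (\<Sum>i<n. (x i)\<^sup>2)" "\<And>i. i < n \<Longrightarrow> (\<Sum>j<n. (A i j)\<^sup>2) \<le> \<kappa>\<^sup>2" "0 \<le> \<kappa>"
    and h: "0 < h" "(\<Sum>i<n. \<Sum>j<n. (A i j)\<^sup>2) \<le> h\<^sup>2"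
  shows "(\<integral>\<^sup>+y. ennreal (quad_form n A y ^ p) \<partial>Pi\<^sub>M {..<n} (\<lambda>_. sparse_normal q b))
    \<le> ennreal ((2 * exp 16 * (8 * b\<^sup>2 * \<kappa> * p + q * b\<^sup>2 * h * sqrt p)) ^ p)"
proof -
  define \<Lambda> where "\<Lambda> = 8 * b\<^sup>2 * \<kappa> + q * b\<^sup>2 * h / sqrt p"
  have p1: "1 \<le> real p" using p by simp
  note sc = chaos_scale[of "q * b\<^sup>2" h \<kappa> p b, OF q(3) h(1) \<kappa>(3) p1, folded \<Lambda>_def]
  have exp_le: "(\<integral>\<^sup>+y. ennreal (exp (l * quad_form n A y)) \<partial>Pi\<^sub>M {..<n} (\<lambda>_. sparse_normal q b)) \<le> ennreal (exp (16 * real p))"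
    if "\<bar>l\<bar> = 1 / \<Lambda>" for l
  proof -
    have l2: "l\<^sup>2 = (1 / \<Lambda>)\<^sup>2" using that by (metis power2_abs)
    have "(\<integral>\<^sup>+y. ennreal (exp (l * quad_form n A y)) \<partial>Pi\<^sub>M {..<n} (\<lambda>_. sparse_normal q b))
      \<le> ennreal (exp (16 * l\<^sup>2 * (q * b\<^sup>2)\<^sup>2 * (\<Sum>i<n. \<Sum>j<n. (A i j)\<^sup>2)))"
      by (rule sparse_chaos_exp_moment[OF q(1,2) A \<kappa>]) (use sc(2) that in simp_all)
    also have "\<dots> \<le> ennreal (exp (16 * l\<^sup>2 * (q * b\<^sup>2)\<^sup>2 * h\<^sup>2))"
      by (intro ennreal_leI, subst exp_le_cancel_iff, intro mult_left_mono h) auto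
    also have "\<dots> \<le> ennreal (exp (16 * real p))"
      using sc(3) unfolding l2 by (intro ennreal_leI) simp
    finally show ?thesis .
  qed
  have "quad_form n A \<in> borel_measurable (Pi\<^sub>M {..<n} (\<lambda>_. sparse_normal q b))"
    by (intro measurable_quad_form measurable_PiM_component_real) auto
  from nn_integral_power_le_exp_moment[OF this p sc(1) exp_le exp_le] show ?thesis
    using sc(1) unfolding sc(4) by simp
qed

lemma sparse_product_sum_moment:
  fixes a :: "nat \<Rightarrow> real"
  assumes q: "0 \<le> q" "q \<le> 1" "0 < q * b\<^sup>2" and p: "even p" "1 \<le> p"
    and \<kappa>: "\<And>i. i < n \<Longrightarrow> \<bar>a i\<bar> \<le> \<kappa>" "0 \<le> \<kappa>"
    and h: "0 < h" "(\<Sum>i<n. (a i)\<^sup>2) \<le> h\<^sup>2"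
  shows "(\<integral>\<^sup>+w. ennreal ((\<Sum>i<n. a i * w i) ^ p) \<partial>Pi\<^sub>M {..<n} (\<lambda>_. sparse_product q b))
    \<le> ennreal ((2 * exp 16 * (8 * b\<^sup>2 * \<kappa> * p + q * b\<^sup>2 * h * sqrt p)) ^ p)"
proof -
  define \<Lambda> where "\<Lambda> = 8 * b\<^sup>2 * \<kappa> + q * b\<^sup>2 * h / sqrt p"
  have p1: "1 \<le> real p" using p by simp
  note sc = chaos_scale[of "q * b\<^sup>2" h \<kappa> p b, OF q(3) h(1) \<kappa>(2) p1, folded \<Lambda>_def]
  have exp_le: "(\<integral>\<^sup>+w. ennreal (exp (l * (\<Sum>i<n. a i * w i))) \<partial>Pi\<^sub>M {..<n} (\<lambda>_. sparse_product q b)) \<le> ennreal (exp (16 * real p))"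
    if "\<bar>l\<bar> = 1 / \<Lambda>" for l
  proof -
    have l2: "l\<^sup>2 = (1 / \<Lambda>)\<^sup>2" using that by (metis power2_abs)
    have "(\<integral>\<^sup>+w. ennreal (exp (l * (\<Sum>i<n. a i * w i))) \<partial>Pi\<^sub>M {..<n} (\<lambda>_. sparse_product q b))
      \<le> ennreal (exp (l\<^sup>2 * (q * b\<^sup>2)\<^sup>2 * (\<Sum>i<n. (a i)\<^sup>2)))"
    proof (rule sparse_product_sum_exp_moment[OF q(1,2)])
      fix i assume "i < n"
      have "\<bar>l * a i\<bar> * b\<^sup>2 \<le> \<bar>l\<bar> * \<kappa> * b\<^sup>2"
        unfolding abs_mult by (intro mult_right_mono mult_left_mono \<kappa> \<open>i < n\<close>) auto
      also have "\<dots> \<le> 1 / 8" using sc(2) that by (simp add: mult_ac)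
      finally have "(\<bar>l * a i\<bar> * b\<^sup>2)\<^sup>2 \<le> (1 / 8)\<^sup>2" by (intro power_mono) auto
      moreover have "(\<bar>l * a i\<bar> * b\<^sup>2)\<^sup>2 = (l * a i)\<^sup>2 * b ^ 4"
        by (simp add: power_mult_distrib power_mult[symmetric])
      ultimately show "(l * a i)\<^sup>2 * b ^ 4 \<le> 1 / 2" by (simp add: power2_eq_square)
    qed
    also have "\<dots> \<le> ennreal (exp (16 * l\<^sup>2 * (q * b\<^sup>2)\<^sup>2 * h\<^sup>2))"
      by (intro ennreal_leI, subst exp_le_cancel_iff, intro mult_mono h)
        (auto intro: sum_nonneg simp: mult_right_mono)
    also have "\<dots> \<le> ennreal (exp (16 * real p))"
      using sc(3) unfolding l2 by (intro ennreal_leI) simp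
    finally show ?thesis .
  qed
  have "(\<lambda>w. \<Sum>i<n. a i * w i) \<in> borel_measurable (Pi\<^sub>M {..<n} (\<lambda>_. sparse_product q b))"
    by (intro borel_measurable_sum borel_measurable_times borel_measurable_const measurable_PiM_component_real) auto
  from nn_integral_power_le_exp_moment[OF this p sc(1) exp_le exp_le] show ?thesis
    using sc(1) unfolding sc(4) by simp
qed

section \<open>Operator norm and Orlicz moments\<close>

lemma sum_mult_delta:
  fixes f :: "nat \<Rightarrow> real"
  assumes "j < n"
  shows "(\<Sum>k<n. f k * (if k = j then 1 else 0)) = f j"
proof -
  have eq: "(\<lambda>k. f k * (if k = j then 1 else 0)) = (\<lambda>k. if k = j then f k else 0)" by auto
  show ?thesis unfolding eq using assms by simp
qed

lemma quad_form_alt: "quad_form n A x = (\<Sum>i<n. (\<Sum>j<n. A i j * x j) * x i)"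
  by (simp add: quad_form_def sum_distrib_left sum_distrib_right mult_ac)

lemma op_norm_bdd_above:
  fixes A :: "nat \<Rightarrow> nat \<Rightarrow> real"
  shows "bdd_above ((\<lambda>x. L2_set (\<lambda>i. \<Sum>j<n. A i j * x j) {..<n}) ` {x. L2_set x {..<n} = 1})"
proof (rule bdd_aboveI2)
  fix x :: "nat \<Rightarrow> real" assume "x \<in> {x. L2_set x {..<n} = 1}"
  then have x: "(\<Sum>j<n. (x j)\<^sup>2) = 1" by (simp add: L2_set_def)
  have "(\<Sum>j<n. A i j * x j)\<^sup>2 \<le> (\<Sum>j<n. (A i j)\<^sup>2)" for i
    using Cauchy_Schwarz_ineq_sum[of "A i" x "{..<n}"] x by simp
  then show "L2_set (\<lambda>i. \<Sum>j<n. A i j * x j) {..<n} \<le> hs_norm n A"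
    unfolding L2_set_def hs_norm_def by (intro real_sqrt_le_mono sum_mono)
qed

lemma L2_set_matrix_le_op_norm:
  "L2_set (\<lambda>i. \<Sum>j<n. A i j * x j) {..<n} \<le> op_norm n A * L2_set x {..<n}"
proof (cases "L2_set x {..<n} = 0")
  case True
  then have "x j = 0" if "j < n" for j using that by (simp add: L2_set_eq_0_iff)
  then show ?thesis by (simp add: True L2_set_def)
next
  case False
  define r where "r = L2_set x {..<n}"
  have r: "0 < r" using False L2_set_nonneg[of x "{..<n}"] by (simp add: r_def less_le)
  define y where "y j = x j / r" for j
  have "L2_set y {..<n} = 1"
  proof -
    have "L2_set (\<lambda>j. (1 / r) * x j) {..<n} = 1 / r * L2_set x {..<n}"
      using r by (intro L2_set_right_distrib[symmetric]) simp
    moreover have "y = (\<lambda>j. (1 / r) * x j)" by (auto simp: y_def)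
    ultimately show ?thesis using r by (simp add: r_def[symmetric])
  qed
  then have "L2_set (\<lambda>i. \<Sum>j<n. A i j * y j) {..<n} \<le> op_norm n A"
    unfolding op_norm_def by (intro cSUP_upper op_norm_bdd_above) simp
  moreover have "L2_set (\<lambda>i. \<Sum>j<n. A i j * x j) {..<n} = r * L2_set (\<lambda>i. \<Sum>j<n. A i j * y j) {..<n}"
    using r by (subst L2_set_right_distrib) (simp_all add: y_def sum_distrib_left)
  ultimately show ?thesis
    using r unfolding r_def[symmetric] by (simp add: mult.commute)
qed

lemma abs_quad_form_le_op_norm:
  "\<bar>quad_form n A x\<bar> \<le> op_norm n A * (\<Sum>i<n. (x i)\<^sup>2)"
proof -
  have "quad_form n A x = (\<Sum>i<n. x i * (\<Sum>j<n. A i j * x j))"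
    by (simp add: quad_form_def sum_distrib_left mult.assoc)
  then have "\<bar>quad_form n A x\<bar> \<le> (\<Sum>i<n. \<bar>x i\<bar> * \<bar>\<Sum>j<n. A i j * x j\<bar>)"
    using sum_abs[of "\<lambda>i. x i * (\<Sum>j<n. A i j * x j)" "{..<n}"] by (simp add: abs_mult)
  also have "\<dots> \<le> L2_set x {..<n} * L2_set (\<lambda>i. \<Sum>j<n. A i j * x j) {..<n}"
    by (rule L2_set_mult_ineq)
  also have "\<dots> \<le> L2_set x {..<n} * (op_norm n A * L2_set x {..<n})"
    by (intro mult_left_mono L2_set_matrix_le_op_norm L2_set_nonneg)
  also have "\<dots> = op_norm n A * (L2_set x {..<n})\<^sup>2" by (simp add: power2_eq_square)
  also have "(L2_set x {..<n})\<^sup>2 = (\<Sum>i<n. (x i)\<^sup>2)" by (simp add: L2_set_def sum_nonneg)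
  finally show ?thesis .
qed

lemma column_le_op_norm:
  assumes "j < n"
  shows "(\<Sum>i<n. (A i j)\<^sup>2) \<le> (op_norm n A)\<^sup>2"
proof -
  define x where "x k = (if k = j then 1 else 0::real)" for k
  have "(\<Sum>k<n. A i k * x k) = A i j" for i
    unfolding x_def using assms by (rule sum_mult_delta)
  moreover have "L2_set x {..<n} = 1"
  proof -
    have "(\<Sum>k<n. (x k)\<^sup>2) = (\<Sum>k<n. 1 * (if k = j then 1 else 0))"
      by (intro sum.cong) (auto simp: x_def)
    then show ?thesis by (simp only: sum_mult_delta[OF assms] L2_set_def real_sqrt_one)
  qed
  ultimately have "sqrt (\<Sum>i<n. (A i j)\<^sup>2) \<le> op_norm n A"
    using L2_set_matrix_le_op_norm[of A x n] by (simp add: L2_set_def)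
  then show ?thesis
    using power_mono[of "sqrt (\<Sum>i<n. (A i j)\<^sup>2)" "op_norm n A" 2] by (simp add: sum_nonneg)
qed

lemma abs_diagonal_le_op_norm:
  assumes "i < n"
  shows "\<bar>A i i\<bar> \<le> op_norm n A"
proof -
  define x where "x k = (if k = i then 1 else 0::real)" for k
  have "quad_form n A x = A i i"
    unfolding quad_form_alt x_def using assms by (simp only: sum_mult_delta)
  moreover have "(\<Sum>k<n. (x k)\<^sup>2) = 1"
  proof -
    have "(\<Sum>k<n. (x k)\<^sup>2) = (\<Sum>k<n. 1 * (if k = i then 1 else 0))"
      by (intro sum.cong) (auto simp: x_def)
    then show ?thesis by (simp only: sum_mult_delta[OF assms])
  qed
  ultimately show ?thesis using abs_quad_form_le_op_norm[of n A x] by simp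
qed

lemma op_norm_nonneg: "1 \<le> n \<Longrightarrow> 0 \<le> op_norm n A"
  using order_trans[OF abs_ge_zero abs_diagonal_le_op_norm[where i = 0 and n = n and A = A]] by simp

lemma powr_self_exp_bound:
  fixes y m :: real
  assumes "0 < y" "0 < m"
  shows "y powr m \<le> m powr m * exp y"
proof -
  have "ln (y / m) \<le> y / m - 1" using assms by (intro ln_le_minus_one) simp
  then have "m * (ln y - ln m) \<le> m * (y / m - 1)" using assms by (intro mult_left_mono) (simp_all add: ln_div)
  then have "m * ln y \<le> m * ln m + y" using assms by (simp add: algebra_simps)
  then have "exp (m * ln y) \<le> exp (m * ln m + y)" by simp
  then show ?thesis using assms by (simp add: powr_def exp_add)
qed

lemma orlicz_norm_abs_moment:
  assumes "0 < \<alpha>" "0 < K" "orlicz_norm M \<alpha> X \<le> ereal K" "1 \<le> k"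
    and [measurable]: "X \<in> borel_measurable M"
  shows "(\<integral>\<^sup>+\<omega>. ennreal (\<bar>X \<omega>\<bar> ^ k) \<partial>M) \<le> ennreal (2 * ((2 * K) ^ k * (k / \<alpha>) powr (k / \<alpha>)))"
proof -
  have "orlicz_norm M \<alpha> X < ereal (2 * K)"
    using assms(2,3) by (intro le_less_trans[OF assms(3)]) simp
  then obtain t where t: "0 < t" "t < 2 * K"
    and E: "(\<integral>\<^sup>+ \<omega>. ennreal (exp ((\<bar>X \<omega>\<bar> / t) powr \<alpha>)) \<partial>M) \<le> 2"
    unfolding orlicz_norm_def INF_less_iff by auto
  define D where "D = (2 * K) ^ k * (k / \<alpha>) powr (k / \<alpha>)"
  have D: "0 \<le> D" using assms by (simp add: D_def)
  have pt: "\<bar>x\<bar> ^ k \<le> D * exp ((\<bar>x\<bar> / t) powr \<alpha>)" for x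
  proof (cases "x = 0")
    case True
    then show ?thesis using assms D by (simp add: power_0_left)
  next
    case False
    define y where "y = (\<bar>x\<bar> / t) powr \<alpha>"
    have y: "0 < y" using False t by (simp add: y_def)
    have "y powr (k / \<alpha>) = (\<bar>x\<bar> / t) ^ k"
      using False t assms by (simp add: y_def powr_powr powr_realpow)
    then have "\<bar>x\<bar> ^ k = t ^ k * y powr (k / \<alpha>)"
      using t by (simp add: power_divide)
    also have "\<dots> \<le> (2 * K) ^ k * ((k / \<alpha>) powr (k / \<alpha>) * exp y)"
      using t assms y by (intro mult_mono power_mono powr_self_exp_bound) auto
    finally show ?thesis by (simp add: D_def y_def mult.assoc)
  qed
  have "(\<integral>\<^sup>+\<omega>. ennreal (\<bar>X \<omega>\<bar> ^ k) \<partial>M) \<le> (\<integral>\<^sup>+\<omega>. ennreal D * ennreal (exp ((\<bar>X \<omega>\<bar> / t) powr \<alpha>)) \<partial>M)"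
    using pt D by (intro nn_integral_mono) (simp add: ennreal_mult'[symmetric] ennreal_leI)
  also have "\<dots> = ennreal D * (\<integral>\<^sup>+\<omega>. ennreal (exp ((\<bar>X \<omega>\<bar> / t) powr \<alpha>)) \<partial>M)"
    by (rule nn_integral_cmult) measurable
  also have "\<dots> \<le> ennreal D * ennreal 2"
    using E by (intro mult_left_mono) simp_all
  also have "\<dots> = ennreal (2 * D)" by (subst ennreal_mult'[symmetric]) (simp_all add: D mult.commute)
  finally show ?thesis unfolding D_def .
qed

lemma orlicz_norm_nonneg: "0 \<le> orlicz_norm M \<alpha> X"
  unfolding orlicz_norm_def by (intro INF_greatest) auto

lemma powr_le_normal_moment:
  fixes \<alpha> R :: real
  assumes \<alpha>: "0 < \<alpha>" "\<alpha> \<le> 2" and R: "0 < R" and k: "even k" "2 \<le> k" "k \<le> p"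
  defines "s \<equiv> 1 / \<alpha> - 1 / 2"
  defines "c \<equiv> 2 * R * exp (2 * s) * \<alpha> powr (- 1 / \<alpha>)"
  shows "R ^ k * (k / \<alpha>) powr (k / \<alpha>) \<le> c ^ k * (real p powr s) ^ (k - 2) * normal_moment k"
proof -
  have s: "0 \<le> s" using \<alpha> by (simp add: s_def field_simps)
  have k0: "0 < real k" using k by simp
  have "(k / \<alpha>) powr (k / \<alpha>) = (\<alpha> powr (- 1 / \<alpha>)) ^ k * k powr (k / \<alpha>)"
  proof -
    have "(\<alpha> powr (- 1 / \<alpha>)) ^ k = \<alpha> powr (- (k / \<alpha>))"
      using \<alpha> by (simp add: powr_realpow[symmetric] powr_powr)
    then show ?thesis using \<alpha> by (simp add: powr_divide powr_minus field_simps)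
  qed
  moreover have "k powr (k / \<alpha>) \<le> 2 ^ k * normal_moment k * exp (2 * s) ^ k * (real p powr s) ^ (k - 2)"
  proof -
    \<comment> \<open>the three exponents are absorbed by the Gaussian moment, by the constant and by \<open>B\<close>\<close>
    have "real k / \<alpha> = k / 2 + 2 * s + real (k - 2) * s"
      using k \<alpha> by (simp add: s_def field_simps of_nat_diff)
    then have "k powr (k / \<alpha>) = k powr (k / 2) * k powr (2 * s) * k powr (real (k - 2) * s)"
      using k0 by (simp add: powr_add)
    also have "\<dots> \<le> (2 ^ k * normal_moment k) * exp (2 * s) ^ k * (real p powr s) ^ (k - 2)"
    proof (intro mult_mono)
      obtain j where j: "k = 2 * j" using k by blast
      have "k powr (k / 2) = real k ^ j" using k0 by (simp add: j powr_realpow)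
      also have "\<dots> = 2 ^ k * (k / 4) ^ (k div 2)"
      proof -
        have "(2::real) ^ k = 4 ^ j" "k div 2 = j" by (simp_all add: j power_mult)
        moreover have "(4 * (real k / 4)) ^ j = 4 ^ j * (k / 4) ^ j" by (rule power_mult_distrib)
        ultimately show ?thesis by simp
      qed
      also have "\<dots> \<le> 2 ^ k * normal_moment k"
        by (intro mult_left_mono normal_moment_lower k) simp
      finally show "k powr (k / 2) \<le> 2 ^ k * normal_moment k" .
      have "real k \<le> exp (real k)" using exp_ge_add_one_self[of "real k"] by linarith
      then have "k powr (2 * s) \<le> exp (real k) powr (2 * s)" using s by (intro powr_mono2) auto
      also have "\<dots> = exp (2 * s) ^ k" by (simp add: powr_def exp_of_nat_mult[symmetric] mult_ac)
      finally show "k powr (2 * s) \<le> exp (2 * s) ^ k" .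
      have "k powr (real (k - 2) * s) \<le> p powr (real (k - 2) * s)"
        using s k by (intro powr_mono2) auto
      also have "\<dots> = (real p powr s) ^ (k - 2)"
        using k by (simp add: powr_realpow[symmetric] powr_powr mult.commute)
      finally show "k powr (real (k - 2) * s) \<le> (real p powr s) ^ (k - 2)" .
    qed (simp_all add: normal_moment_nonneg)
    finally show ?thesis .
  qed
  ultimately have "R ^ k * (k / \<alpha>) powr (k / \<alpha>)
      \<le> R ^ k * ((\<alpha> powr (- 1 / \<alpha>)) ^ k * (2 ^ k * normal_moment k * exp (2 * s) ^ k * (real p powr s) ^ (k - 2)))"
    using R by (auto intro!: mult_left_mono)
  also have "\<dots> = c ^ k * (real p powr s) ^ (k - 2) * normal_moment k"
    unfolding c_def power_mult_distrib by (simp only: mult_ac)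
  finally show ?thesis .
qed

lemma sparse_moment_lower:
  fixes \<alpha> R K :: real
  assumes \<alpha>: "0 < \<alpha>" "\<alpha> \<le> 2" and R: "0 < R" and K: "0 < K" and k: "even k" "2 \<le> k" "k \<le> p"
  defines "s \<equiv> 1 / \<alpha> - 1 / 2"
  defines "c \<equiv> 2 * R * exp (2 * s) * \<alpha> powr (- 1 / \<alpha>)"
  defines "B \<equiv> real p powr s"
  shows "(R * K) ^ k * (k / \<alpha>) powr (k / \<alpha>) \<le> sparse_moment (1 / B\<^sup>2) (c * K * B) k"
proof -
  have B: "0 < B" using k by (simp add: B_def)
  have "(R * K) ^ k * (k / \<alpha>) powr (k / \<alpha>) = K ^ k * (R ^ k * (k / \<alpha>) powr (k / \<alpha>))"
    by (simp add: power_mult_distrib)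
  also have "\<dots> \<le> K ^ k * (c ^ k * B ^ (k - 2) * normal_moment k)"
    using powr_le_normal_moment[OF \<alpha> R k] K by (intro mult_left_mono) (simp_all add: s_def c_def B_def)
  also have "\<dots> = sparse_moment (1 / B\<^sup>2) (c * K * B) k"
  proof -
    have "B ^ k = B\<^sup>2 * B ^ (k - 2)" using k by (metis le_add_diff_inverse power_add)
    then show ?thesis using k B by (simp add: sparse_moment_def power_mult_distrib)
  qed
  finally show ?thesis .
qed

lemma (in prob_space) indep_vars_affine_power_le:
  fixes X :: "nat \<Rightarrow> 'a \<Rightarrow> real" and f :: "(nat \<Rightarrow> real) \<Rightarrow> real"
  assumes "1 \<le> n" and indep: "indep_vars (\<lambda>_. borel) X {..<n}"
    and X: "\<And>i. X i \<in> borel_measurable M"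
    and \<nu>: "\<And>i. prob_space (\<nu> i)" "\<And>i. sets (\<nu> i) = sets borel"
    and le: "\<And>i a b. i < n \<Longrightarrow>
      (\<integral>\<^sup>+\<omega>. ennreal ((a + b * X i \<omega>) ^ p) \<partial>M) \<le> (\<integral>\<^sup>+y. ennreal ((a + b * y) ^ p) \<partial>\<nu> i)"
    and f: "f \<in> borel_measurable (Pi\<^sub>M UNIV (\<lambda>_. borel))"
    and cong: "\<And>x y. (\<And>i. i < n \<Longrightarrow> x i = y i) \<Longrightarrow> f x = f y"
    and affine: "\<And>i x. i < n \<Longrightarrow> \<exists>b. \<forall>y. f (x(i := y)) = f (x(i := 0)) + b * (y :: real)"
  shows "(\<integral>\<^sup>+\<omega>. ennreal (f (\<lambda>i. X i \<omega>) ^ p) \<partial>M) \<le> (\<integral>\<^sup>+x. ennreal (f x ^ p) \<partial>Pi\<^sub>M {..<n} \<nu>)"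
proof -
  define Y where "Y \<omega> = (\<lambda>i\<in>{..<n}. X i \<omega>)" for \<omega>
  have Y: "Y \<in> measurable M (Pi\<^sub>M {..<n} (\<lambda>_. borel))"
    unfolding Y_def by (rule measurable_restrict) (rule X)
  have dist: "distr M (Pi\<^sub>M {..<n} (\<lambda>_. borel)) Y = Pi\<^sub>M {..<n} (\<lambda>i. distr M borel (X i))"
    using indep X \<open>1 \<le> n\<close> unfolding Y_def
    by (subst (asm) indep_vars_iff_distr_eq_PiM) (auto simp: lessThan_empty_iff)
  have "(\<lambda>x. ennreal (f x ^ p)) \<in> borel_measurable (Pi\<^sub>M {..<n} (\<lambda>_. borel))"
    by (intro measurable_compose[OF _ measurable_ennreal] borel_measurable_power
        measurable_compose[OF measurable_PiM_UNIV_real f]) simp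
  then have nn: "(\<integral>\<^sup>+x. ennreal (f x ^ p) \<partial>distr M (Pi\<^sub>M {..<n} (\<lambda>_. borel)) Y)
      = (\<integral>\<^sup>+\<omega>. ennreal (f (Y \<omega>) ^ p) \<partial>M)"
    by (intro nn_integral_distr[OF Y]) simp
  have "f (Y \<omega>) = f (\<lambda>i. X i \<omega>)" for \<omega> by (rule cong) (simp add: Y_def)
  then have "(\<integral>\<^sup>+\<omega>. ennreal (f (\<lambda>i. X i \<omega>) ^ p) \<partial>M) = (\<integral>\<^sup>+x. ennreal (f x ^ p) \<partial>Pi\<^sub>M {..<n} (\<lambda>i. distr M borel (X i)))"
    unfolding dist[symmetric] nn by simp
  also have "\<dots> \<le> (\<integral>\<^sup>+x. ennreal (f x ^ p) \<partial>Pi\<^sub>M {..<n} \<nu>)"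
  proof (rule nn_integral_PiM_affine_power_mono)
    show "prob_space (distr M borel (X i))" for i by (rule prob_space_distr) (rule X)
    fix i a b assume "i \<in> {..<n}"
    then show "(\<integral>\<^sup>+y. ennreal ((a + b * y) ^ p) \<partial>distr M borel (X i)) \<le> (\<integral>\<^sup>+y. ennreal ((a + b * y) ^ p) \<partial>\<nu> i)"
      using le[of i a b] X by (subst nn_integral_distr) auto
  qed (use \<nu> f affine in auto)
  finally show ?thesis .
qed

lemma (in prob_space) orlicz_norm_moment:
  fixes X :: "'a \<Rightarrow> real"
  assumes "0 < \<alpha>" "0 < K" "orlicz_norm M \<alpha> X \<le> ereal K" and X [measurable]: "X \<in> borel_measurable M"
  shows "integrable M (\<lambda>\<omega>. X \<omega> ^ k)"
    and "even k \<Longrightarrow> 1 \<le> k \<Longrightarrow> expectation (\<lambda>\<omega>. X \<omega> ^ k) \<le> 2 * ((2 * K) ^ k * (k / \<alpha>) powr (k / \<alpha>))"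
proof -
  show int: "integrable M (\<lambda>\<omega>. X \<omega> ^ k)"
  proof (cases "k = 0")
    case False
    then have "(\<integral>\<^sup>+\<omega>. ennreal (norm (X \<omega> ^ k)) \<partial>M) < \<infinity>"
      using orlicz_norm_abs_moment[OF assms(1-3) _ X, of k]
      by (simp add: power_abs) (metis ennreal_less_top le_less_trans infinity_ennreal_def)
    then show ?thesis by (intro integrableI_bounded) simp_all
  qed simp
  assume k: "even k" "1 \<le> k"
  have "ennreal (expectation (\<lambda>\<omega>. X \<omega> ^ k)) = (\<integral>\<^sup>+\<omega>. ennreal (X \<omega> ^ k) \<partial>M)"
    using k by (intro nn_integral_eq_integral[symmetric] int) (simp add: zero_le_even_power)
  also have "\<dots> \<le> ennreal (2 * ((2 * K) ^ k * (k / \<alpha>) powr (k / \<alpha>)))"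
    using orlicz_norm_abs_moment[OF assms(1-3) k(2) X] k(1) by (simp add: power_even_abs)
  finally show "expectation (\<lambda>\<omega>. X \<omega> ^ k) \<le> 2 * ((2 * K) ^ k * (k / \<alpha>) powr (k / \<alpha>))"
    using assms by (subst (asm) ennreal_le_iff) auto
qed

text \<open>
  The factor 8 covers \<open>2 ^ k\<close> from \<open>convex_power_average\<close>, \<open>2 ^ k\<close> from the use of \<open>2 * K\<close> in place of \<open>K\<close>
  and the leading 2 of the moment bound; \<open>2 powr (1 / \<alpha>)\<close> is needed for the moments of order \<open>2 * k\<close> of
  the squares on the diagonal.
\<close>

definition moment_radius :: "real \<Rightarrow> real" where
  "moment_radius \<alpha> = 8 * 2 powr (1 / \<alpha>)"

definition sparse_scale :: "real \<Rightarrow> real" where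
  "sparse_scale \<alpha> = 2 * moment_radius \<alpha> * exp (2 * (1 / \<alpha> - 1 / 2)) * \<alpha> powr (- 1 / \<alpha>)"

definition sparsity :: "real \<Rightarrow> nat \<Rightarrow> real" where
  "sparsity \<alpha> p = real p powr (1 / \<alpha> - 1 / 2)"

lemma moment_radius_ge: "0 < \<alpha> \<Longrightarrow> 8 \<le> moment_radius \<alpha>"
  by (simp add: moment_radius_def ge_one_powr_ge_zero)

lemma sparsity_ge_1:
  assumes "0 < \<alpha>" "\<alpha> \<le> 2" "2 \<le> p"
  shows "1 \<le> sparsity \<alpha> p"
  unfolding sparsity_def using assms by (intro ge_one_powr_ge_zero) (auto simp: field_simps)

lemma sparse_moment_ge:
  assumes "0 < \<alpha>" "\<alpha> \<le> 2" "0 < K" "even k" "2 \<le> k" "k \<le> p"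
  shows "(moment_radius \<alpha> * K) ^ k * (k / \<alpha>) powr (k / \<alpha>)
    \<le> sparse_moment (1 / (sparsity \<alpha> p)\<^sup>2) (sparse_scale \<alpha> * K * sparsity \<alpha> p) k"
  using sparse_moment_lower[of \<alpha> "moment_radius \<alpha>" K k p] moment_radius_ge[of \<alpha>] assms
  unfolding sparse_scale_def sparsity_def by simp

lemma (in prob_space) affine_power_le_sparse_normal:
  fixes X :: "'a \<Rightarrow> real"
  assumes \<alpha>: "0 < \<alpha>" "\<alpha> \<le> 2" and K: "0 < K" and X: "orlicz_norm M \<alpha> X \<le> ereal K" "X \<in> borel_measurable M"
    and zero: "expectation X = 0" and p: "even p" "2 \<le> p"
  shows "(\<integral>\<^sup>+\<omega>. ennreal ((a + c * X \<omega>) ^ p) \<partial>M)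
    \<le> (\<integral>\<^sup>+y. ennreal ((a + c * y) ^ p) \<partial>sparse_normal (1 / (sparsity \<alpha> p)\<^sup>2) (sparse_scale \<alpha> * K * sparsity \<alpha> p))"
proof -
  have B: "1 \<le> sparsity \<alpha> p" using sparsity_ge_1 \<alpha> p by simp
  show ?thesis
  proof (subst nn_integral_sparse_normal_affine_power[OF p(1)])
    show "1 / (sparsity \<alpha> p)\<^sup>2 \<le> 1" using B by (simp add: field_simps)
    show "(\<integral>\<^sup>+\<omega>. ennreal ((a + c * X \<omega>) ^ p) \<partial>M)
      \<le> ennreal (\<Sum>k\<in>evens p. (p choose k) * c ^ k * a ^ (p - k) *
          sparse_moment (1 / (sparsity \<alpha> p)\<^sup>2) (sparse_scale \<alpha> * K * sparsity \<alpha> p) k)"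
    proof (rule nn_integral_affine_power_le[OF p])
      show "integrable M (\<lambda>\<omega>. X \<omega> ^ k)" for k by (rule orlicz_norm_moment(1)[OF \<alpha>(1) K X])
      show "expectation X = 0" by fact
      show "sparse_moment (1 / (sparsity \<alpha> p)\<^sup>2) (sparse_scale \<alpha> * K * sparsity \<alpha> p) 0 = 1"
        by (simp add: sparse_moment_def)
      fix k :: nat assume k: "2 \<le> k" "k \<in> evens p"
      define \<mu> where "\<mu> = (k / \<alpha>) powr (k / \<alpha>)"
      have \<mu>: "0 \<le> \<mu>" by (simp add: \<mu>_def)
      have "2 ^ k * expectation (\<lambda>\<omega>. X \<omega> ^ k) \<le> 2 ^ k * (2 * ((2 * K) ^ k * \<mu>))"
        using orlicz_norm_moment(2)[OF \<alpha>(1) K X, of k] k unfolding \<mu>_def by (intro mult_left_mono) auto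
      also have "\<dots> = (2 * 4 ^ k) * (K ^ k * \<mu>)"
      proof -
        have "(4::real) ^ k = 2 ^ k * 2 ^ k" by (simp flip: power_mult_distrib)
        then show ?thesis by (simp add: power_mult_distrib)
      qed
      also have "\<dots> \<le> (moment_radius \<alpha>) ^ k * (K ^ k * \<mu>)"
      proof (intro mult_right_mono)
        have "(2::real) ^ 1 \<le> 2 ^ k" using k by (intro power_increasing) auto
        then have "2 * (4::real) ^ k \<le> 2 ^ k * 4 ^ k" by simp
        also have "\<dots> = 8 ^ k" by (simp flip: power_mult_distrib)
        also have "\<dots> \<le> moment_radius \<alpha> ^ k" using moment_radius_ge[OF \<alpha>(1)] by (intro power_mono) auto
        finally show "2 * 4 ^ k \<le> moment_radius \<alpha> ^ k" .
      qed (use K \<mu> in auto)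
      also have "\<dots> = (moment_radius \<alpha> * K) ^ k * \<mu>" by (simp add: power_mult_distrib)
      also have "\<dots> \<le> sparse_moment (1 / (sparsity \<alpha> p)\<^sup>2) (sparse_scale \<alpha> * K * sparsity \<alpha> p) k"
        unfolding \<mu>_def using k by (intro sparse_moment_ge \<alpha> K) auto
      finally show "2 ^ k * expectation (\<lambda>\<omega>. X \<omega> ^ k)
        \<le> sparse_moment (1 / (sparsity \<alpha> p)\<^sup>2) (sparse_scale \<alpha> * K * sparsity \<alpha> p) k" .
    qed
  qed simp
qed

lemma even_power_diff_le:
  fixes x m :: real
  assumes "even k" "0 \<le> x" "0 \<le> m"
  shows "(x - m) ^ k \<le> x ^ k + m ^ k"
proof -
  have "(x - m) ^ k = \<bar>x - m\<bar> ^ k" using assms by (simp add: power_even_abs)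
  also have "\<dots> \<le> max x m ^ k" using assms by (intro power_mono) auto
  also have "\<dots> \<le> x ^ k + m ^ k" using assms by (auto simp: max_def)
  finally show ?thesis .
qed

lemma (in prob_space) affine_power_le_sparse_product:
  fixes X :: "'a \<Rightarrow> real"
  assumes \<alpha>: "0 < \<alpha>" "\<alpha> \<le> 2" and K: "0 < K" and X: "orlicz_norm M \<alpha> X \<le> ereal K" "X \<in> borel_measurable M"
    and p: "even p" "2 \<le> p"
  defines "m \<equiv> expectation (\<lambda>\<omega>. (X \<omega>)\<^sup>2)"
  shows "(\<integral>\<^sup>+\<omega>. ennreal ((a + c * ((X \<omega>)\<^sup>2 - m)) ^ p) \<partial>M)
    \<le> (\<integral>\<^sup>+y. ennreal ((a + c * y) ^ p) \<partial>sparse_product (1 / (sparsity \<alpha> p)\<^sup>2) (sparse_scale \<alpha> * K * sparsity \<alpha> p))"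
proof -
  have B: "1 \<le> sparsity \<alpha> p" using sparsity_ge_1 \<alpha> p by simp
  note mom = orlicz_norm_moment[OF \<alpha>(1) K X]
  have m0: "0 \<le> m" unfolding m_def by (rule integral_nonneg_AE) simp
  have intZ: "integrable M (\<lambda>\<omega>. ((X \<omega>)\<^sup>2 - m) ^ k)" for k
  proof -
    have "((X \<omega>)\<^sup>2 - m) ^ k = (\<Sum>j\<le>k. (k choose j) * X \<omega> ^ (2 * j) * (- m) ^ (k - j))" for \<omega>
      using binomial_ring[of "(X \<omega>)\<^sup>2" "- m" k] by (simp add: power_mult)
    then show ?thesis
      by (simp only:) (intro Bochner_Integration.integrable_sum integrable_mult_left integrable_mult_right mom)
  qed
  show ?thesis
  proof (subst nn_integral_sparse_product_affine_power[OF p(1)])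
    show "1 / (sparsity \<alpha> p)\<^sup>2 \<le> 1" using B by (simp add: field_simps)
    show "(\<integral>\<^sup>+\<omega>. ennreal ((a + c * ((X \<omega>)\<^sup>2 - m)) ^ p) \<partial>M)
      \<le> ennreal (\<Sum>k\<in>evens p. (p choose k) * c ^ k * a ^ (p - k) *
          (sparse_moment (1 / (sparsity \<alpha> p)\<^sup>2) (sparse_scale \<alpha> * K * sparsity \<alpha> p) k)\<^sup>2)"
    proof (rule nn_integral_affine_power_le[OF p intZ])
      show "expectation (\<lambda>\<omega>. (X \<omega>)\<^sup>2 - m) = 0"
        using mom(1)[of 2] by (simp add: m_def prob_space)
      show "(sparse_moment (1 / (sparsity \<alpha> p)\<^sup>2) (sparse_scale \<alpha> * K * sparsity \<alpha> p) 0)\<^sup>2 = 1"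
        by (simp add: sparse_moment_def)
      fix k :: nat assume k: "2 \<le> k" "k \<in> evens p"
      define \<mu> where "\<mu> j = (j / \<alpha>) powr (j / \<alpha>)" for j :: nat
      have \<mu>: "0 \<le> \<mu> j" for j by (simp add: \<mu>_def)
      define w where "w = 2 powr (1 / \<alpha>)"
      have w: "0 \<le> w" by (simp add: w_def)
      have \<mu>2: "\<mu> (2 * k) = w ^ (2 * k) * (\<mu> k)\<^sup>2"
      proof -
        have "\<mu> (2 * k) = (2 * (k / \<alpha>)) powr (2 * (k / \<alpha>))" by (simp add: \<mu>_def)
        also have "\<dots> = 2 powr (2 * (k / \<alpha>)) * (k / \<alpha>) powr (2 * (k / \<alpha>))"
          using \<alpha> by (subst powr_mult) auto
        also have "2 powr (2 * (k / \<alpha>)) = w ^ (2 * k)"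
          by (simp add: w_def powr_realpow[symmetric] powr_powr)
        also have "(k / \<alpha>) powr (2 * (k / \<alpha>)) = (\<mu> k)\<^sup>2"
          unfolding mult_2 powr_add by (simp add: \<mu>_def power2_eq_square)
        finally show ?thesis .
      qed
      have \<mu>k: "(\<mu> 2) ^ k \<le> \<mu> (2 * k)"
      proof -
        have "(\<mu> 2) ^ k = (2 / \<alpha>) powr (2 * k / \<alpha>)"
          using \<alpha> by (simp add: \<mu>_def powr_realpow[symmetric] powr_powr)
        also have "\<dots> \<le> (2 * k / \<alpha>) powr (2 * k / \<alpha>)"
          using \<alpha> k by (intro powr_mono2) (auto simp: divide_right_mono)
        finally show ?thesis by (simp add: \<mu>_def)
      qed
      have "m ^ k \<le> (2 * ((2 * K)\<^sup>2 * \<mu> 2)) ^ k"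
        using mom(2)[of 2] m0 unfolding m_def \<mu>_def by (intro power_mono) auto
      also have "\<dots> = 2 ^ k * ((2 * K) ^ (2 * k) * \<mu> 2 ^ k)"
        unfolding power_mult_distrib[of 2 "(2 * K)\<^sup>2 * _"] power_mult_distrib[of "(2 * K)\<^sup>2"] power_mult ..
      also have "\<dots> \<le> 2 ^ k * ((2 * K) ^ (2 * k) * \<mu> (2 * k))"
        using K by (intro mult_left_mono \<mu>k) auto
      finally have mk: "m ^ k \<le> 2 ^ k * ((2 * K) ^ (2 * k) * \<mu> (2 * k))" .
      have "expectation (\<lambda>\<omega>. ((X \<omega>)\<^sup>2 - m) ^ k) \<le> expectation (\<lambda>\<omega>. X \<omega> ^ (2 * k) + m ^ k)"
        using k m0 by (intro integral_mono intZ Bochner_Integration.integrable_add mom(1) integrable_const)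
          (simp add: power_mult even_power_diff_le)
      also have "\<dots> = expectation (\<lambda>\<omega>. X \<omega> ^ (2 * k)) + m ^ k"
        by (subst Bochner_Integration.integral_add) (auto simp: mom(1) prob_space)
      also have "\<dots> \<le> 2 * ((2 * K) ^ (2 * k) * \<mu> (2 * k)) + 2 ^ k * ((2 * K) ^ (2 * k) * \<mu> (2 * k))"
        using mom(2)[of "2 * k"] k mk by (intro add_mono) (auto simp: \<mu>_def)
      also have "\<dots> = (2 + 2 ^ k) * ((2 * K) ^ (2 * k) * \<mu> (2 * k))" by (simp add: algebra_simps)
      also have "\<dots> \<le> (2 * 2 ^ k) * ((2 * K) ^ (2 * k) * \<mu> (2 * k))"
      proof (rule mult_right_mono)
        have "(2::real) ^ 1 \<le> 2 ^ k" using k by (intro power_increasing) auto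
        then show "2 + 2 ^ k \<le> 2 * (2::real) ^ k" by simp
      qed (use K \<mu> in auto)
      finally have "2 ^ k * expectation (\<lambda>\<omega>. ((X \<omega>)\<^sup>2 - m) ^ k)
          \<le> 2 ^ k * ((2 * 2 ^ k) * ((2 * K) ^ (2 * k) * \<mu> (2 * k)))"
        by (intro mult_left_mono) auto
      also have "\<dots> = (2 * 16 ^ k) * (w ^ (2 * k) * K ^ (2 * k) * (\<mu> k)\<^sup>2)"
      proof -
        have "(2::real) ^ k * 2 ^ k * 2 ^ (2 * k) = 16 ^ k"
          by (simp add: power_mult flip: power_mult_distrib)
        then show ?thesis unfolding \<mu>2 power_mult_distrib by (simp add: mult_ac)
      qed
      also have "\<dots> \<le> 64 ^ k * (w ^ (2 * k) * K ^ (2 * k) * (\<mu> k)\<^sup>2)"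
      proof (rule mult_right_mono)
        have "(2::real) ^ 1 \<le> 4 ^ k" using k power_increasing[of 1 k "4::real"] by simp
        then have "2 * (16::real) ^ k \<le> 4 ^ k * 16 ^ k" by simp
        also have "\<dots> = 64 ^ k" by (simp flip: power_mult_distrib)
        finally show "2 * (16::real) ^ k \<le> 64 ^ k" .
      qed (use K w in auto)
      also have "\<dots> = ((moment_radius \<alpha> * K) ^ k * \<mu> k)\<^sup>2"
      proof -
        have "(64::real) ^ k = 8 ^ (2 * k)" by (simp add: power_mult)
        then show ?thesis
          unfolding moment_radius_def w_def[symmetric]
          by (simp add: power_mult_distrib power_mult[symmetric] mult_ac)
      qed
      also have "\<dots> \<le> (sparse_moment (1 / (sparsity \<alpha> p)\<^sup>2) (sparse_scale \<alpha> * K * sparsity \<alpha> p) k)\<^sup>2"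
        using k sparse_moment_ge[OF \<alpha> K, of k p] moment_radius_ge[OF \<alpha>(1)] K \<mu>[of k]
        unfolding \<mu>_def by (intro power_mono) auto
      finally show "2 ^ k * expectation (\<lambda>\<omega>. ((X \<omega>)\<^sup>2 - m) ^ k)
        \<le> (sparse_moment (1 / (sparsity \<alpha> p)\<^sup>2) (sparse_scale \<alpha> * K * sparsity \<alpha> p) k)\<^sup>2" .
    qed
  qed simp
qed

section \<open>Moments of quadratic forms\<close>

lemma quad_form_affine:
  assumes "A i i = 0"
  shows "\<exists>b. \<forall>y. quad_form n A (x(i := y)) = quad_form n A (x(i := 0)) + b * y"
proof -
  define z where "z = x(i := 0)"
  define g where "g k j = (if k = i then A i j * z j else 0) + (if j = i then z k * A k i else 0)" for k j
  have "(x(i := y)) k * A k j * (x(i := y)) j = z k * A k j * z j + g k j * y" for k j y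
    using assms by (auto simp: g_def z_def)
  then have "quad_form n A (x(i := y)) = quad_form n A z + (\<Sum>k<n. \<Sum>j<n. g k j) * y" for y
    unfolding quad_form_def by (simp add: sum.distrib sum_distrib_right)
  then show ?thesis unfolding z_def by blast
qed

lemma sum_affine:
  fixes a :: "nat \<Rightarrow> real"
  assumes "i < n"
  shows "\<exists>b. \<forall>y. (\<Sum>k<n. a k * (x(i := y)) k) = (\<Sum>k<n. a k * (x(i := 0)) k) + b * y"
proof -
  have "(\<Sum>k<n. a k * (x(i := y)) k) = (\<Sum>k<n. a k * (x(i := 0)) k) + a i * y" for y
    using sum.remove[of "{..<n}" i "\<lambda>k. a k * (x(i := y)) k"]
      sum.remove[of "{..<n}" i "\<lambda>k. a k * (x(i := 0)) k"] assms
    by simp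
  then show ?thesis by blast
qed

lemma quad_form_split_diagonal:
  "quad_form n A x = quad_form n (\<lambda>i j. if i < n \<and> j < n \<and> i \<noteq> j then A i j else 0) x + (\<Sum>i<n. A i i * (x i)\<^sup>2)"
proof -
  have "(\<Sum>j<n. x i * A i j * x j)
      = (\<Sum>j<n. x i * (if i < n \<and> j < n \<and> i \<noteq> j then A i j else 0) * x j) + A i i * (x i)\<^sup>2" if "i < n" for i
  proof -
    have "(\<Sum>j<n. x i * A i j * x j)
      = (\<Sum>j<n. x i * (if i < n \<and> j < n \<and> i \<noteq> j then A i j else 0) * x j + (if j = i then A i i * (x i)\<^sup>2 else 0))"
      using that by (intro sum.cong) (auto simp: power2_eq_square)
    then show ?thesis using that by (simp add: sum.distrib)
  qed
  then show ?thesis unfolding quad_form_def by (simp add: sum.distrib)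
qed

lemma power_add_le_even:
  fixes u v :: real
  assumes "even p"
  shows "(u + v) ^ p \<le> 2 ^ p * (u ^ p + v ^ p)"
proof -
  have "(u + v) ^ p = \<bar>u + v\<bar> ^ p" using assms by (simp add: power_even_abs)
  also have "\<dots> \<le> (2 * max \<bar>u\<bar> \<bar>v\<bar>) ^ p" by (intro power_mono) auto
  also have "\<dots> = 2 ^ p * max \<bar>u\<bar> \<bar>v\<bar> ^ p" by (rule power_mult_distrib)
  also have "\<dots> \<le> 2 ^ p * (\<bar>u\<bar> ^ p + \<bar>v\<bar> ^ p)"
    by (intro mult_left_mono) (auto simp: max_def)
  finally show ?thesis using assms by (simp add: power_even_abs)
qed

lemma (in prob_space) expectation_mult_indep_vars:
  fixes X :: "nat \<Rightarrow> 'a \<Rightarrow> real"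
  assumes "indep_vars (\<lambda>_. borel) X {..<n}" "i < n" "j < n" "i \<noteq> j"
    and "integrable M (X i)" "integrable M (X j)"
  shows "integrable M (\<lambda>\<omega>. X i \<omega> * X j \<omega>)"
    and "expectation (\<lambda>\<omega>. X i \<omega> * X j \<omega>) = expectation (X i) * expectation (X j)"
proof -
  have "indep_vars (\<lambda>_. borel) X {i, j}"
    by (rule indep_vars_subset[OF assms(1)]) (use assms in auto)
  from indep_vars_integrable[OF _ this] indep_vars_lebesgue_integral[OF _ this] assms
  show "integrable M (\<lambda>\<omega>. X i \<omega> * X j \<omega>)"
    and "expectation (\<lambda>\<omega>. X i \<omega> * X j \<omega>) = expectation (X i) * expectation (X j)"
    by auto
qed

lemma sparse_scale_pos: "0 < \<alpha> \<Longrightarrow> 0 < sparse_scale \<alpha>"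
  using moment_radius_ge[of \<alpha>] by (simp add: sparse_scale_def)

lemma hs_norm_sq: "(hs_norm n A)\<^sup>2 = (\<Sum>i<n. \<Sum>j<n. (A i j)\<^sup>2)"
  unfolding hs_norm_def by (intro real_sqrt_pow2 sum_nonneg) simp

lemma (in prob_space) expectation_quad_form:
  fixes X :: "nat \<Rightarrow> 'a \<Rightarrow> real"
  assumes "indep_vars (\<lambda>_. borel) X {..<n}"
    and "\<And>i. i < n \<Longrightarrow> integrable M (X i)" "\<And>i. i < n \<Longrightarrow> integrable M (\<lambda>\<omega>. (X i \<omega>)\<^sup>2)"
    and "\<And>i. i < n \<Longrightarrow> expectation (X i) = 0"
  shows "expectation (\<lambda>\<omega>. quad_form n A (\<lambda>i. X i \<omega>)) = (\<Sum>i<n. A i i * expectation (\<lambda>\<omega>. (X i \<omega>)\<^sup>2))"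
proof -
  have 1: "integrable M (\<lambda>\<omega>. X i \<omega> * A i j * X j \<omega>)" if "i < n" "j < n" for i j
  proof -
    have "integrable M (\<lambda>\<omega>. A i j * (X i \<omega> * X j \<omega>))"
    proof (cases "i = j")
      case True
      then show ?thesis using assms(3)[of i] that by (simp add: power2_eq_square)
    next
      case False
      then show ?thesis using expectation_mult_indep_vars(1)[OF assms(1), of i j] assms(2) that by simp
    qed
    then show ?thesis by (simp add: mult_ac)
  qed
  have 2: "expectation (\<lambda>\<omega>. X i \<omega> * A i j * X j \<omega>) = (if j = i then A i i * expectation (\<lambda>\<omega>. (X i \<omega>)\<^sup>2) else 0)"
    if "i < n" "j < n" for i j
  proof -
    have "expectation (\<lambda>\<omega>. X i \<omega> * A i j * X j \<omega>) = A i j * expectation (\<lambda>\<omega>. X i \<omega> * X j \<omega>)"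
      by (subst integral_mult_right_zero[symmetric]) (simp add: mult_ac)
    then show ?thesis
      using expectation_mult_indep_vars(2)[OF assms(1), of i j] assms(2,4) that
      by (auto simp: power2_eq_square)
  qed
  have "expectation (\<lambda>\<omega>. quad_form n A (\<lambda>i. X i \<omega>)) = (\<Sum>i<n. \<Sum>j<n. expectation (\<lambda>\<omega>. X i \<omega> * A i j * X j \<omega>))"
    unfolding quad_form_def using 1
    by (subst Bochner_Integration.integral_sum, force intro!: Bochner_Integration.integrable_sum)
      (intro sum.cong refl Bochner_Integration.integral_sum; simp)
  also have "\<dots> = (\<Sum>i<n. A i i * expectation (\<lambda>\<omega>. (X i \<omega>)\<^sup>2))"
    by (intro sum.cong refl) (simp add: 2)
  finally show ?thesis .
qed

lemma (in prob_space) quad_form_central_moment_le: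
  fixes X :: "nat \<Rightarrow> 'a \<Rightarrow> real"
  assumes \<alpha>: "0 < \<alpha>" "\<alpha> \<le> 2" and K: "0 < K" and n: "1 \<le> n"
    and indep: "indep_vars (\<lambda>_. borel) X {..<n}"
    and X: "\<And>i. X i \<in> borel_measurable M"
    and zero: "\<And>i. i < n \<Longrightarrow> expectation (X i) = 0"
    and orlicz: "\<And>i. i < n \<Longrightarrow> orlicz_norm M \<alpha> (X i) \<le> ereal K"
    and sym: "\<And>i j. i < n \<Longrightarrow> j < n \<Longrightarrow> A i j = A j i"
    and p: "even p" "2 \<le> p" and h: "0 < hs_norm n A"
  defines "Q \<equiv> \<lambda>\<omega>. quad_form n A (\<lambda>i. X i \<omega>)"
  shows "(\<integral>\<^sup>+\<omega>. ennreal ((Q \<omega> - expectation Q) ^ p) \<partial>M)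
    \<le> ennreal ((8 * exp 16 * (sparse_scale \<alpha> * K)\<^sup>2 *
        (16 * op_norm n A * real p powr (2 / \<alpha>) + hs_norm n A * sqrt p)) ^ p)"
proof -
  define B where "B = sparsity \<alpha> p"
  define q where "q = 1 / B\<^sup>2"
  define v where "v = (sparse_scale \<alpha> * K)\<^sup>2"
  define b where "b = sparse_scale \<alpha> * K * B"
  define A0 where "A0 = (\<lambda>i j. if i < n \<and> j < n \<and> i \<noteq> j then A i j else 0)"
  define \<kappa> where "\<kappa> = 2 * op_norm n A"
  define h where "h = hs_norm n A"
  define m where "m i = expectation (\<lambda>\<omega>. (X i \<omega>)\<^sup>2)" for i
  define Z where "Z i \<omega> = (X i \<omega>)\<^sup>2 - m i" for i \<omega>
  define G where "G = 2 * exp 16 * (8 * b\<^sup>2 * \<kappa> * p + q * b\<^sup>2 * h * sqrt p)"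
  have B: "1 \<le> B" using sparsity_ge_1[OF \<alpha>] p by (simp add: B_def)
  have q: "0 \<le> q" "q \<le> 1" using B by (auto simp: q_def field_simps)
  have v: "0 < v" using sparse_scale_pos[OF \<alpha>(1)] K by (simp add: v_def)
  have b2: "b\<^sup>2 = v * B\<^sup>2" by (simp add: b_def v_def power_mult_distrib)
  have qb: "q * b\<^sup>2 = v" using B by (simp add: b2 q_def)
  have op: "0 \<le> op_norm n A" by (rule op_norm_nonneg[OF n])
  have \<kappa>: "0 \<le> \<kappa>" "op_norm n A \<le> \<kappa>" using op by (auto simp: \<kappa>_def)
  have h: "0 < h" "h\<^sup>2 = (\<Sum>i<n. \<Sum>j<n. (A i j)\<^sup>2)" using h by (auto simp: h_def hs_norm_sq)
  have split: "quad_form n A x = quad_form n A0 x + (\<Sum>i<n. A i i * (x i)\<^sup>2)" for x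
    unfolding A0_def by (rule quad_form_split_diagonal)
  have A0le: "(A0 i j)\<^sup>2 \<le> (A i j)\<^sup>2" for i j by (simp add: A0_def)
  have p1: "1 \<le> p" using p by simp
  have G: "0 \<le> G" unfolding G_def using \<kappa> q h
    by (intro mult_nonneg_nonneg add_nonneg_nonneg) simp_all
  have U: "(\<integral>\<^sup>+\<omega>. ennreal (quad_form n A0 (\<lambda>i. X i \<omega>) ^ p) \<partial>M) \<le> ennreal (G ^ p)"
  proof -
    have "(\<integral>\<^sup>+\<omega>. ennreal (quad_form n A0 (\<lambda>i. X i \<omega>) ^ p) \<partial>M)
        \<le> (\<integral>\<^sup>+y. ennreal (quad_form n A0 y ^ p) \<partial>Pi\<^sub>M {..<n} (\<lambda>_. sparse_normal q b))"
    proof (rule indep_vars_affine_power_le[OF n indep X])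
      fix i a c assume "i < n"
      then show "(\<integral>\<^sup>+\<omega>. ennreal ((a + c * X i \<omega>) ^ p) \<partial>M) \<le> (\<integral>\<^sup>+y. ennreal ((a + c * y) ^ p) \<partial>sparse_normal q b)"
        unfolding q_def b_def B_def
        by (intro affine_power_le_sparse_normal \<alpha> K orlicz X zero p)
    qed (auto intro: prob_space_sparse_normal measurable_quad_form_PiM_UNIV quad_form_cong
        intro!: quad_form_affine simp: A0_def)
    also have "\<dots> \<le> ennreal (G ^ p)"
      unfolding G_def
    proof (rule sparse_chaos_moment[OF q _ p(1) p1])
      show "0 < q * b\<^sup>2" using qb v by simp
      show "A0 i j = A0 j i" for i j using sym by (auto simp: A0_def)
      show "A0 i i = 0" for i by (simp add: A0_def)
      show "0 \<le> \<kappa>" "0 < h" by fact+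
      fix x :: "nat \<Rightarrow> real"
      have "\<bar>\<Sum>i<n. A i i * (x i)\<^sup>2\<bar> \<le> (\<Sum>i<n. \<bar>A i i * (x i)\<^sup>2\<bar>)" by (rule sum_abs)
      also have "\<dots> \<le> (\<Sum>i<n. op_norm n A * (x i)\<^sup>2)"
        by (intro sum_mono) (auto simp: abs_mult intro!: mult_right_mono abs_diagonal_le_op_norm)
      finally show "\<bar>quad_form n A0 x\<bar> \<le> \<kappa> * (\<Sum>i<n. (x i)\<^sup>2)"
        using abs_quad_form_le_op_norm[of n A x] split[of x] by (simp add: \<kappa>_def sum_distrib_left[symmetric])
    next
      fix i assume i: "i < n"
      have "(\<Sum>j<n. (A0 i j)\<^sup>2) \<le> (\<Sum>j<n. (A j i)\<^sup>2)"
        using A0le[of i] sym[OF i] by (intro sum_mono) (metis lessThan_iff)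
      also have "\<dots> \<le> (op_norm n A)\<^sup>2" by (rule column_le_op_norm[OF i])
      also have "\<dots> \<le> \<kappa>\<^sup>2" using op \<kappa> by (intro power_mono)
      finally show "(\<Sum>j<n. (A0 i j)\<^sup>2) \<le> \<kappa>\<^sup>2" .
    next
      show "(\<Sum>i<n. \<Sum>j<n. (A0 i j)\<^sup>2) \<le> h\<^sup>2" unfolding h(2) by (intro sum_mono A0le)
    qed
    finally show ?thesis .
  qed
  have V: "(\<integral>\<^sup>+\<omega>. ennreal ((\<Sum>i<n. A i i * Z i \<omega>) ^ p) \<partial>M) \<le> ennreal (G ^ p)"
  proof -
    have indepZ: "indep_vars (\<lambda>_. borel) Z {..<n}"
      unfolding Z_def by (rule indep_vars_compose2[OF indep]) measurable
    have Z: "Z i \<in> borel_measurable M" for i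
    proof -
      note [measurable] = X
      show ?thesis unfolding Z_def by measurable
    qed
    have "(\<integral>\<^sup>+\<omega>. ennreal ((\<Sum>i<n. A i i * Z i \<omega>) ^ p) \<partial>M)
        \<le> (\<integral>\<^sup>+y. ennreal ((\<Sum>i<n. A i i * y i) ^ p) \<partial>Pi\<^sub>M {..<n} (\<lambda>_. sparse_product q b))"
    proof (rule indep_vars_affine_power_le[OF n indepZ Z])
      fix i a c assume "i < n"
      then show "(\<integral>\<^sup>+\<omega>. ennreal ((a + c * Z i \<omega>) ^ p) \<partial>M) \<le> (\<integral>\<^sup>+y. ennreal ((a + c * y) ^ p) \<partial>sparse_product q b)"
        unfolding q_def b_def B_def Z_def m_def
        by (intro affine_power_le_sparse_product \<alpha> K orlicz X p)
    next
      fix i x assume "i < n"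
      then show "\<exists>c. \<forall>y. (\<Sum>k<n. A k k * (x(i := y)) k) = (\<Sum>k<n. A k k * (x(i := 0)) k) + c * y"
        by (rule sum_affine)
    qed (auto intro: prob_space_sparse_product)
    also have "\<dots> \<le> ennreal (G ^ p)"
      unfolding G_def
    proof (rule sparse_product_sum_moment[OF q _ p(1) p1])
      show "0 < q * b\<^sup>2" using qb v by simp
      show "\<bar>A i i\<bar> \<le> \<kappa>" if "i < n" for i using abs_diagonal_le_op_norm[OF that, of A] \<kappa> by simp
      show "0 \<le> \<kappa>" "0 < h" by fact+
      show "(\<Sum>i<n. (A i i)\<^sup>2) \<le> h\<^sup>2"
        unfolding h(2) by (intro sum_mono member_le_sum) auto
    qed
    finally show ?thesis .
  qed
  have mom: "integrable M (\<lambda>\<omega>. X i \<omega> ^ k)" if "i < n" for i k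
    by (rule orlicz_norm_moment(1)[OF \<alpha>(1) K orlicz[OF that] X])
  have EQ: "expectation Q = (\<Sum>i<n. A i i * m i)"
    unfolding Q_def m_def
    by (rule expectation_quad_form[OF indep]) (use mom[of _ 1] mom[of _ 2] zero in simp_all)
  have QE: "Q \<omega> - expectation Q = quad_form n A0 (\<lambda>i. X i \<omega>) + (\<Sum>i<n. A i i * Z i \<omega>)" for \<omega>
    unfolding EQ unfolding Q_def split Z_def by (simp add: algebra_simps sum_subtractf)
  have "(\<integral>\<^sup>+\<omega>. ennreal ((Q \<omega> - expectation Q) ^ p) \<partial>M)
      \<le> (\<integral>\<^sup>+\<omega>. ennreal (2 ^ p) * (ennreal (quad_form n A0 (\<lambda>i. X i \<omega>) ^ p) + ennreal ((\<Sum>i<n. A i i * Z i \<omega>) ^ p)) \<partial>M)"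
    unfolding QE using p(1)
    by (intro nn_integral_mono)
      (simp add: ennreal_mult'[symmetric] ennreal_plus[symmetric] zero_le_even_power ennreal_leI power_add_le_even del: ennreal_plus)
  also have "\<dots> = ennreal (2 ^ p) * ((\<integral>\<^sup>+\<omega>. ennreal (quad_form n A0 (\<lambda>i. X i \<omega>) ^ p) \<partial>M) + (\<integral>\<^sup>+\<omega>. ennreal ((\<Sum>i<n. A i i * Z i \<omega>) ^ p) \<partial>M))"
  proof -
    note [measurable] = X measurable_quad_form[of n "\<lambda>\<omega> i. X i \<omega>" M A0, OF X]
    have [measurable]: "Z i \<in> borel_measurable M" for i unfolding Z_def by measurable
    show ?thesis by (subst nn_integral_cmult, measurable, subst nn_integral_add, measurable)
  qed
  also have "\<dots> \<le> ennreal (2 ^ p) * (ennreal (G ^ p) + ennreal (G ^ p))"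
    by (intro mult_left_mono add_mono U V) simp
  also have "\<dots> = ennreal (2 ^ p * (2 * G ^ p))"
    using G by (simp add: ennreal_mult'[symmetric] ennreal_plus[symmetric] del: ennreal_plus)
  also have "\<dots> \<le> ennreal ((4 * G) ^ p)"
  proof (rule ennreal_leI)
    have "(2::real) ^ 1 \<le> 2 ^ p" using p1 by (intro power_increasing) auto
    then have "2 ^ p * (2 * G ^ p) \<le> 2 ^ p * (2 ^ p * G ^ p)"
      using G by (intro mult_left_mono mult_right_mono) auto
    also have "\<dots> = (2 * (2 * G)) ^ p" by (simp only: power_mult_distrib)
    also have "2 * (2 * G) = 4 * G" by simp
    finally show "2 ^ p * (2 * G ^ p) \<le> (4 * G) ^ p" .
  qed
  also have "4 * G = 8 * exp 16 * (sparse_scale \<alpha> * K)\<^sup>2 *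
        (16 * op_norm n A * real p powr (2 / \<alpha>) + hs_norm n A * sqrt p)"
  proof -
    have "B\<^sup>2 * p = real p powr (2 / \<alpha>)"
    proof -
      have "2 / \<alpha> = 2 * (1 / \<alpha> - 1 / 2) + 1" by simp
      then have "real p powr (2 / \<alpha>) = real p powr (2 * (1 / \<alpha> - 1 / 2)) * p"
        using p by (simp only: powr_add) simp
      also have "real p powr (2 * (1 / \<alpha> - 1 / 2)) = B\<^sup>2"
        unfolding B_def sparsity_def mult_2 powr_add by (simp add: power2_eq_square)
      finally show ?thesis by simp
    qed
    then have "8 * b\<^sup>2 * \<kappa> * p = v * (16 * op_norm n A * real p powr (2 / \<alpha>))"
      by (simp add: b2 \<kappa>_def)
    then show ?thesis
      unfolding G_def qb h_def v_def[symmetric] by (simp add: algebra_simps)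
  qed
  finally show ?thesis .
qed

section \<open>Tail bounds\<close>

definition tail_const :: "real \<Rightarrow> real" where
  "tail_const \<alpha> = 4 * (1 + 17 * exp 1 * (8 * exp 16 * (sparse_scale \<alpha>)\<^sup>2))\<^sup>2"

lemma tail_const_pos: "0 < tail_const \<alpha>"
proof -
  have "0 \<le> 17 * exp 1 * (8 * exp 16 * (sparse_scale \<alpha>)\<^sup>2)" by simp
  then show ?thesis unfolding tail_const_def by (smt (verit) zero_less_power)
qed

lemma (in prob_space) prob_ge_le_moment:
  assumes f [measurable]: "f \<in> borel_measurable M" and p: "even p" and t: "0 < t" and G: "0 \<le> G"
    and le: "(\<integral>\<^sup>+\<omega>. ennreal (f \<omega> ^ p) \<partial>M) \<le> ennreal (G ^ p)"
  shows "prob {\<omega> \<in> space M. t \<le> \<bar>f \<omega>\<bar>} \<le> (G / t) ^ p"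
proof -
  define E where "E = {\<omega> \<in> space M. t \<le> \<bar>f \<omega>\<bar>}"
  have E [measurable]: "E \<in> events" unfolding E_def by measurable
  have "ennreal (t ^ p * prob E) = ennreal (t ^ p) * emeasure M E"
    using t by (simp add: ennreal_mult' emeasure_eq_measure)
  also have "\<dots> = (\<integral>\<^sup>+\<omega>. ennreal (t ^ p) * indicator E \<omega> \<partial>M)"
    by (simp add: nn_integral_cmult_indicator)
  also have "\<dots> \<le> (\<integral>\<^sup>+\<omega>. ennreal (f \<omega> ^ p) \<partial>M)"
  proof (rule nn_integral_mono)
    fix \<omega>
    show "ennreal (t ^ p) * indicator E \<omega> \<le> ennreal (f \<omega> ^ p)"
    proof (cases "\<omega> \<in> E")
      case True
      then have "t ^ p \<le> \<bar>f \<omega>\<bar> ^ p" using t by (intro power_mono) (auto simp: E_def)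
      then show ?thesis using True p by (simp add: power_even_abs ennreal_leI)
    qed simp
  qed
  also note le
  finally have "t ^ p * prob E \<le> G ^ p" using G by (simp add: ennreal_le_iff)
  then show ?thesis using t unfolding E_def by (simp add: power_divide field_simps)
qed

lemma (in prob_space) quad_form_tail:
  fixes X :: "nat \<Rightarrow> 'a \<Rightarrow> real"
  assumes \<alpha>: "0 < \<alpha>" "\<alpha> \<le> 2" and K: "0 < K" and n: "1 \<le> n"
    and indep: "indep_vars (\<lambda>_. borel) X {..<n}"
    and X: "\<And>i. X i \<in> borel_measurable M"
    and zero: "\<And>i. i < n \<Longrightarrow> expectation (X i) = 0"
    and orlicz: "\<And>i. i < n \<Longrightarrow> orlicz_norm M \<alpha> (X i) \<le> ereal K"
    and sym: "\<And>i j. i < n \<Longrightarrow> j < n \<Longrightarrow> A i j = A j i"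
    and h: "0 < hs_norm n A" and op: "0 < op_norm n A" and t: "0 < t"
  defines "Q \<equiv> \<lambda>\<omega>. quad_form n A (\<lambda>i. X i \<omega>)"
  shows "prob {\<omega> \<in> space M. t \<le> \<bar>Q \<omega> - expectation Q\<bar>}
    \<le> 2 * exp (- (1 / tail_const \<alpha>) * min (t\<^sup>2 / (K ^ 4 * (hs_norm n A)\<^sup>2)) ((t / (K\<^sup>2 * op_norm n A)) powr (\<alpha> / 2)))"
proof -
  define h where "h = hs_norm n A"
  define \<kappa> where "\<kappa> = op_norm n A"
  define m where "m = min (t\<^sup>2 / (K ^ 4 * h\<^sup>2)) ((t / (K\<^sup>2 * \<kappa>)) powr (\<alpha> / 2))"
  define D where "D = 8 * exp 16 * (sparse_scale \<alpha>)\<^sup>2"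
  define r where "r = 1 / (1 + 17 * exp 1 * D)"
  have h0: "0 < h" and o0: "0 < \<kappa>" using h op by (simp_all add: h_def \<kappa>_def)
  have D: "0 < D" using sparse_scale_pos[OF \<alpha>(1)] by (simp add: D_def)
  then have den: "1 \<le> 1 + 17 * exp 1 * D" "0 < 1 + 17 * exp 1 * D" by (simp_all add: add_pos_pos)
  have r: "0 < r" "r \<le> 1" using den by (simp_all add: r_def)
  have rD: "17 * D * r \<le> exp (- 1)"
  proof -
    have "17 * exp 1 * D * r \<le> 1" using den by (simp add: r_def)
    then show ?thesis by (simp add: exp_minus field_simps)
  qed
  have C: "1 / tail_const \<alpha> = r\<^sup>2 / 4"
    by (simp add: tail_const_def r_def D_def power_divide)
  have m0: "0 \<le> m" by (simp add: m_def)
  have m1: "m \<le> t\<^sup>2 / (K ^ 4 * h\<^sup>2)" and m2: "m \<le> (t / (K\<^sup>2 * \<kappa>)) powr (\<alpha> / 2)"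
    by (simp_all add: m_def)
  have goal: "prob {\<omega> \<in> space M. t \<le> \<bar>Q \<omega> - expectation Q\<bar>} \<le> 2 * exp (- (r\<^sup>2 / 4) * m)"
  proof (cases "r\<^sup>2 * m < 2")
    case True
    have "1 / 2 \<le> exp (- (1 / 2) :: real)" using exp_ge_add_one_self[of "- (1 / 2) :: real"] by simp
    also have "\<dots> \<le> exp (- (r\<^sup>2 / 4) * m)" using True by (simp add: mult.commute)
    finally show ?thesis using prob_le_1[of "{\<omega> \<in> space M. t \<le> \<bar>Q \<omega> - expectation Q\<bar>}"] by linarith
  next
    case False
    define N where "N = nat \<lfloor>r\<^sup>2 * m / 2\<rfloor>"
    define p where "p = 2 * N"
    have "1 \<le> \<lfloor>r\<^sup>2 * m / 2\<rfloor>" using False by (simp add: le_floor_iff)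
    then have N: "1 \<le> N" "real N \<le> r\<^sup>2 * m / 2" "r\<^sup>2 * m / 2 < real N + 1"
      unfolding N_def using of_int_floor_le[of "r\<^sup>2 * m / 2"] real_of_int_floor_add_one_gt[of "r\<^sup>2 * m / 2"]
      by (auto simp: nat_le_iff of_nat_nat le_nat_iff)
    have p: "even p" "2 \<le> p" "real p \<le> r\<^sup>2 * m" "r\<^sup>2 * m / 2 \<le> real p"
      using N by (auto simp: p_def)
    have "sqrt p * h \<le> r * t / K\<^sup>2"
    proof -
      have "real p \<le> r\<^sup>2 * (t\<^sup>2 / (K ^ 4 * h\<^sup>2))"
        using p(3) mult_left_mono[OF m1, of "r\<^sup>2"] by simp
      also have "\<dots> = (r * t / (K\<^sup>2 * h))\<^sup>2"
        by (simp add: power_mult_distrib power_divide power_mult[symmetric])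
      finally have "sqrt p \<le> r * t / (K\<^sup>2 * h)"
        using r t K h0 by (intro real_le_lsqrt) auto
      then have "sqrt p * h \<le> r * t / (K\<^sup>2 * h) * h" using h0 by (intro mult_right_mono) auto
      then show ?thesis using h0 by simp
    qed
    moreover have "\<kappa> * real p powr (2 / \<alpha>) \<le> r * t / K\<^sup>2"
    proof -
      have "real p powr (2 / \<alpha>) \<le> (r\<^sup>2 * (t / (K\<^sup>2 * \<kappa>)) powr (\<alpha> / 2)) powr (2 / \<alpha>)"
        using p(2,3) mult_left_mono[OF m2, of "r\<^sup>2"] \<alpha> by (intro powr_mono2) auto
      also have "\<dots> = (r\<^sup>2) powr (2 / \<alpha>) * (t / (K\<^sup>2 * \<kappa>))"
        using r \<alpha> t K o0 by (simp add: powr_mult powr_powr)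
      also have "\<dots> \<le> r * (t / (K\<^sup>2 * \<kappa>))"
      proof (rule mult_right_mono)
        have "(r\<^sup>2) powr (2 / \<alpha>) \<le> (r\<^sup>2) powr 1"
          using r \<alpha> by (intro powr_mono') (auto simp: power_le_one field_simps)
        also have "\<dots> \<le> r" using r by (simp add: power2_eq_square mult_left_le)
        finally show "(r\<^sup>2) powr (2 / \<alpha>) \<le> r" .
      qed (use t K o0 in auto)
      finally have "real p powr (2 / \<alpha>) \<le> r * (t / (K\<^sup>2 * \<kappa>))" .
      then have "\<kappa> * real p powr (2 / \<alpha>) \<le> \<kappa> * (r * (t / (K\<^sup>2 * \<kappa>)))" using o0 by (intro mult_left_mono) auto
      then show ?thesis using o0 by simp
    qed
    ultimately have "16 * (\<kappa> * real p powr (2 / \<alpha>)) + sqrt p * h \<le> 17 * (r * t / K\<^sup>2)"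
      by linarith
    then have "16 * \<kappa> * real p powr (2 / \<alpha>) + h * sqrt p \<le> 17 * (r * t / K\<^sup>2)"
      by (simp only: mult.assoc mult.commute[of h])
    then have "D * K\<^sup>2 * (16 * \<kappa> * real p powr (2 / \<alpha>) + h * sqrt p) \<le> D * K\<^sup>2 * (17 * (r * t / K\<^sup>2))"
      using D by (intro mult_left_mono) auto
    also have "\<dots> = 17 * D * r * t" using K by simp
    also have "\<dots> \<le> exp (- 1) * t" using rD t by (intro mult_right_mono) auto
    finally have G: "D * K\<^sup>2 * (16 * \<kappa> * real p powr (2 / \<alpha>) + h * sqrt p) \<le> exp (- 1) * t" .
    define G where "G = D * K\<^sup>2 * (16 * \<kappa> * real p powr (2 / \<alpha>) + h * sqrt p)"
    have G0: "0 \<le> G" unfolding G_def using D o0 h0 by simp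
    have "(\<integral>\<^sup>+\<omega>. ennreal ((Q \<omega> - expectation Q) ^ p) \<partial>M) \<le> ennreal (G ^ p)"
      using quad_form_central_moment_le[OF \<alpha> K n indep X zero orlicz sym p(1,2) h]
      by (simp add: Q_def G_def D_def \<kappa>_def h_def power_mult_distrib mult_ac)
    then have "prob {\<omega> \<in> space M. t \<le> \<bar>Q \<omega> - expectation Q\<bar>} \<le> (G / t) ^ p"
      unfolding Q_def using measurable_quad_form[of n "\<lambda>\<omega> i. X i \<omega>" M A, OF X]
      by (intro prob_ge_le_moment p t G0) auto
    also have "\<dots> \<le> exp (- 1) ^ p"
    proof (rule power_mono)
      show "G / t \<le> exp (- 1)" using G t unfolding G_def[symmetric] by (simp add: pos_divide_le_eq)
      show "0 \<le> G / t" using G0 t by simp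
    qed
    also have "\<dots> = exp (- real p)" by (simp flip: exp_of_nat_mult)
    also have "\<dots> \<le> exp (- (r\<^sup>2 / 4) * m)"
    proof -
      have "r\<^sup>2 / 4 * m \<le> r\<^sup>2 * m / 2" using m0 by simp
      then have "- real p \<le> - (r\<^sup>2 / 4) * m" using p(4) by simp
      then show ?thesis by simp
    qed
    also have "\<dots> \<le> 2 * exp (- (r\<^sup>2 / 4) * m)" by simp
    finally show ?thesis .
  qed
  then show ?thesis unfolding C m_def h_def \<kappa>_def .
qed

lemma quad_form_tail_bound_tail_const:
  fixes \<alpha> :: real
  assumes \<alpha>: "0 < \<alpha>" "\<alpha> \<le> 2"
  shows "quad_form_tail_bound TYPE('a) \<alpha> (tail_const \<alpha>)"
  unfolding quad_form_tail_bound_def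
proof (intro allI impI)
  fix M :: "'a measure" and n :: nat and X :: "nat \<Rightarrow> 'a \<Rightarrow> real" and K :: real
    and A :: "nat \<Rightarrow> nat \<Rightarrow> real" and t :: real
  assume "prob_space M" and n: "1 \<le> n" and indep: "prob_space.indep_vars M (\<lambda>_. borel) X {..<n}"
    and zero: "\<forall>i<n. integrable M (X i) \<and> (\<integral>\<omega>. X i \<omega> \<partial>M) = 0"
    and orlicz: "\<forall>i<n. orlicz_norm M \<alpha> (X i) \<le> ereal K"
    and sym: "\<forall>i<n. \<forall>j<n. A i j = A j i" and t: "0 \<le> t"
  interpret prob_space M by fact
  define Y where "Y i = (if i < n then X i else (\<lambda>_. 0))" for i
  have eq: "quad_form n A (\<lambda>i. Y i \<omega>) = quad_form n A (\<lambda>i. X i \<omega>)" for \<omega>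
    by (rule quad_form_cong) (simp add: Y_def)
  have indepY: "indep_vars (\<lambda>_. borel) Y {..<n}"
    using indep by (subst indep_vars_cong[of _ "{..<n}" _ X _ "\<lambda>_. borel"]) (auto simp: Y_def)
  have Y: "Y i \<in> borel_measurable M" for i
    using zero by (auto simp: Y_def)
  have "0 \<le> ereal K" using orlicz_norm_nonneg order_trans orlicz n by (metis less_le_trans zero_less_one)
  then have K: "0 \<le> K" by simp
  let ?m = "min (t\<^sup>2 / (K ^ 4 * (hs_norm n A)\<^sup>2)) ((t / (K\<^sup>2 * op_norm n A)) powr (\<alpha> / 2))"
  show "prob {\<omega> \<in> space M. t \<le> \<bar>quad_form n A (\<lambda>i. X i \<omega>) - (\<integral>\<omega>'. quad_form n A (\<lambda>i. X i \<omega>') \<partial>M)\<bar>}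
      \<le> 2 * exp (- (1 / tail_const \<alpha>) * ?m)"
  proof (cases "t = 0 \<or> K = 0 \<or> hs_norm n A = 0 \<or> op_norm n A = 0")
    case True
    have "0 \<le> ?m" by simp
    moreover have "?m \<le> 0" using True \<alpha> by auto
    ultimately have "?m = 0" by linarith
    then have "2 * exp (- (1 / tail_const \<alpha>) * ?m) = 2" by simp
    then show ?thesis using prob_le_1 by (smt (verit))
  next
    case False
    have "0 \<le> hs_norm n A" unfolding hs_norm_def by (intro real_sqrt_ge_zero sum_nonneg) simp
    then have "0 < K" "0 < hs_norm n A" "0 < op_norm n A" "0 < t"
      using False K t op_norm_nonneg[OF n, of A] by auto
    then show ?thesis
      using quad_form_tail[OF \<alpha> _ n indepY Y, of K A t] zero orlicz sym
      unfolding eq by (auto simp: Y_def)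
  qed
qed

lemma quad_form_tail_bound_transfer:
  assumes "quad_form_tail_bound TYPE(nat \<Rightarrow> real) \<alpha> C"
  shows "quad_form_tail_bound TYPE('a) \<alpha> C"
  unfolding quad_form_tail_bound_def
proof (intro allI impI)
  fix M :: "'a measure" and n :: nat and X :: "nat \<Rightarrow> 'a \<Rightarrow> real" and K :: real
    and A :: "nat \<Rightarrow> nat \<Rightarrow> real" and t :: real
  assume "prob_space M" and n: "1 \<le> n" and indep: "prob_space.indep_vars M (\<lambda>_. borel) X {..<n}"
    and zero: "\<forall>i<n. integrable M (X i) \<and> (\<integral>\<omega>. X i \<omega> \<partial>M) = 0"
    and orlicz: "\<forall>i<n. orlicz_norm M \<alpha> (X i) \<le> ereal K"
    and sym: "\<forall>i<n. \<forall>j<n. A i j = A j i" and t: "0 \<le> t"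
  interpret prob_space M by fact
  let ?P = "Pi\<^sub>M {..<n} (\<lambda>_. borel :: real measure)"
  define Y where "Y \<omega> = (\<lambda>i\<in>{..<n}. X i \<omega>)" for \<omega>
  have X: "X i \<in> borel_measurable M" if "i < n" for i using zero that by auto
  have Y [measurable]: "Y \<in> measurable M ?P"
    unfolding Y_def by (rule measurable_restrict) (use X in auto)
  define N where "N = distr M ?P Y"
  interpret N: prob_space N unfolding N_def by (rule prob_space_distr) (rule Y)
  have Yi: "Y \<omega> i = X i \<omega>" if "i < n" for i \<omega> using that by (simp add: Y_def)
  have proj [measurable]: "(\<lambda>y. y i) \<in> borel_measurable ?P" if "i < n" for i
    using that by (intro measurable_component_singleton) simp
  have sets: "sets N = sets ?P" by (simp add: N_def)
  have distr_i: "distr N borel (\<lambda>y. y i) = distr M borel (X i)" if "i < n" for i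
    unfolding N_def using that by (subst distr_distr[OF proj Y]) (auto simp: comp_def Yi)
  have indepN: "N.indep_vars (\<lambda>_. borel) (\<lambda>i y. y i) {..<n}"
  proof (subst N.indep_vars_iff_distr_eq_PiM')
    have "distr N ?P (\<lambda>y. \<lambda>i\<in>{..<n}. y i) = distr N ?P (\<lambda>y. y)"
      by (intro distr_cong) (auto simp: N_def space_PiM PiE_restrict)
    also have "\<dots> = N" by (rule distr_id2) (simp add: sets)
    also have "\<dots> = Pi\<^sub>M {..<n} (\<lambda>i. distr M borel (X i))"
      unfolding N_def Y_def using indep n X
      by (subst (asm) indep_vars_iff_distr_eq_PiM') (auto simp: lessThan_empty_iff)
    also have "\<dots> = Pi\<^sub>M {..<n} (\<lambda>i. distr N borel (\<lambda>y. y i))"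
      by (intro PiM_cong) (auto simp: distr_i)
    finally show "distr N ?P (\<lambda>y. \<lambda>i\<in>{..<n}. y i) = Pi\<^sub>M {..<n} (\<lambda>i. distr N borel (\<lambda>y. y i))" .
    show "{..<n} \<noteq> {}" using n by (auto simp: lessThan_empty_iff)
    show "(\<lambda>y. y i) \<in> borel_measurable N" if "i \<in> {..<n}" for i
      using proj[of i] that sets by (simp cong: measurable_cong_sets)
  qed
  have q: "quad_form n A (\<lambda>i. Y \<omega> i) = quad_form n A (\<lambda>i. X i \<omega>)" for \<omega>
    by (rule quad_form_cong) (rule Yi)
  have qm [measurable]: "(\<lambda>y. quad_form n A (\<lambda>i. y i)) \<in> borel_measurable ?P"
    by (rule measurable_quad_form) (rule proj)
  have Nq: "(\<integral>y. quad_form n A (\<lambda>i. y i) \<partial>N) = (\<integral>\<omega>. quad_form n A (\<lambda>i. X i \<omega>) \<partial>M)"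
    unfolding N_def by (subst integral_distr[OF Y qm]) (simp only: q)
  have N1: "integrable N (\<lambda>y. y i) \<and> (\<integral>y. y i \<partial>N) = 0" if "i < n" for i
    unfolding N_def using zero that
    by (subst integrable_distr_eq[OF Y proj], simp, subst integral_distr[OF Y proj]) (auto simp: Yi)
  have N2: "orlicz_norm N \<alpha> (\<lambda>y. y i) \<le> ereal K" if "i < n" for i
  proof -
    have "(\<integral>\<^sup>+y. ennreal (exp ((\<bar>y i\<bar> / s) powr \<alpha>)) \<partial>N) = (\<integral>\<^sup>+\<omega>. ennreal (exp ((\<bar>X i \<omega>\<bar> / s) powr \<alpha>)) \<partial>M)" for s
    proof -
      note [measurable] = proj[OF that]
      show ?thesis unfolding N_def by (subst nn_integral_distr[OF Y]) (auto simp: Yi[OF that])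
    qed
    then show ?thesis using orlicz that unfolding orlicz_norm_def by simp
  qed
  have "measure N {y \<in> space N. t \<le> \<bar>quad_form n A (\<lambda>i. y i) - (\<integral>y. quad_form n A (\<lambda>i. y i) \<partial>N)\<bar>}
      \<le> 2 * exp (- (1 / C) * min (t\<^sup>2 / (K ^ 4 * (hs_norm n A)\<^sup>2)) ((t / (K\<^sup>2 * op_norm n A)) powr (\<alpha> / 2)))"
    using assms[unfolded quad_form_tail_bound_def, rule_format, of N n "\<lambda>i y. y i" K A t]
      N.prob_space_axioms n indepN N1 N2 sym t by blast
  also have "measure N {y \<in> space N. t \<le> \<bar>quad_form n A (\<lambda>i. y i) - (\<integral>y. quad_form n A (\<lambda>i. y i) \<partial>N)\<bar>}
      = measure M {\<omega> \<in> space M. t \<le> \<bar>quad_form n A (\<lambda>i. X i \<omega>) - (\<integral>\<omega>'. quad_form n A (\<lambda>i. X i \<omega>') \<partial>M)\<bar>}"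
  proof -
    have "{y \<in> space ?P. t \<le> \<bar>quad_form n A (\<lambda>i. y i) - (\<integral>\<omega>'. quad_form n A (\<lambda>i. X i \<omega>') \<partial>M)\<bar>} \<in> sets ?P"
      by measurable
    moreover have "Y \<omega> \<in> space ?P" if "\<omega> \<in> space M" for \<omega> using measurable_space[OF Y that] .
    ultimately show ?thesis
      unfolding Nq unfolding N_def
      by (subst measure_distr[OF Y]) (auto simp: q[symmetric] intro!: arg_cong[where f = prob])
  qed
  finally show "prob {\<omega> \<in> space M. t \<le> \<bar>quad_form n A (\<lambda>i. X i \<omega>) - (\<integral>\<omega>'. quad_form n A (\<lambda>i. X i \<omega>') \<partial>M)\<bar>}
      \<le> 2 * exp (- (1 / C) * min (t\<^sup>2 / (K ^ 4 * (hs_norm n A)\<^sup>2)) ((t / (K\<^sup>2 * op_norm n A)) powr (\<alpha> / 2)))" .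
qed

(* HOL cannot quantify over types below an existential, so "there is C such that for every sample
   type" is split: some C works for the sample type nat => real, and any such C works for the
   arbitrary sample type 'a as well. Hence C depends on alpha alone, not on 'a. *)
theorem theorem2p1:
  fixes \<alpha> :: real
  assumes "0 < \<alpha>" and "\<alpha> \<le> 2"
  shows "(\<exists>C>0. quad_form_tail_bound TYPE(nat \<Rightarrow> real) \<alpha> C) \<and>
         (\<forall>C>0. quad_form_tail_bound TYPE(nat \<Rightarrow> real) \<alpha> C \<longrightarrow> quad_form_tail_bound TYPE('a) \<alpha> C)"
  using quad_form_tail_bound_tail_const[OF assms] tail_const_pos quad_form_tail_bound_transfer by blast

end
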